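(* Consider the control-affine randomly switched system $\dot x=f_\sigma(x)+\sum_{i=1}^m g_{\sigma,i}(x)u_i$, $x(0)=x_0$, $t\ge0$. Suppose that there are real numbers $\widetilde\lambda,\overline\lambda>0$ and $M\in\mathbb{N}\cup\{0\}$ such that $\mathsf{P}(N_\sigma(t)=k)\le \frac{(\overline\lambda t)^k e^{-\widetilde\lambda t}}{k!}$ for all $k\ge M$ and all $t\ge0$, and that there exist continuously differentiable functions $V_p:\mathbb{R}^n\to\mathbb{R}_{\ge0}$, $p\in\mathcal{P}$, functions $\alpha_1,\alpha_2\in\mathcal{K}_\infty$, and real numbers $\lambda_\circ>0$, $\mu>1$, such that (C1) $\alpha_1(\|x\|)\le V_p(x)\le\alpha_2(\|x\|)$ for all $x\in\mathbb{R}^n$, $p\in\mathcal{P}$; (C2) $V_{p_1}(x)\le\mu V_{p_2}(x)$ for all $x\in\mathbb{R}^n$, $p_1,p_2\in\mathcal{P}$; (C3) for all $x\in\mathbb{R}^n\setminus\{0\}$ and all $p\in\mathcal{P}$, $$\inf_{u\in\mathbb{R}^m}\Big\{\mathrm{L}_{f_p}V_p(x)+\lambda_\circ V_p(x)+\sum_{i=1}^m u_i\,\mathrm{L}_{g_{p,i}}V_p(x)\Big\}<0;$$ (C4) for every $\varepsilon>0$ there exists $\delta>0$ such that if $x\neq0$ satisfies $\|x\|<\delta$, then there exists $u\in\mathbb{R}^m$ with $\|u\|<\varepsilon$ such that for all $p\in\mathcal{P}$ $$\mathrm{L}_{f_p}V_p(x)+\sum_{i=1}^m u_i\,\mathrm{L}_{g_{p,i}}V_p(x)\le-\lambda_\circ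 V_p(x);$$ (C5) $\mu<(\lambda_\circ+\widetilde\lambda)/\overline\lambda$. Then the feedback control $\overline u_\sigma(x)=[k_{\sigma,1}(x),\ldots,k_{\sigma,m}(x)]^{\mathrm T}$, where $$k_{p,i}(x):=-\mathrm{L}_{g_{p,i}}V_p(x)\cdot\varphi\big(\overline W_p(x),\widetilde W_p(x)\big),\qquad \overline W_p(x):=\mathrm{L}_{f_p}V_p(x)+\lambda_\circ V_p(x),\qquad \widetilde W_p(x):=\sum_{i=1}^m\big(\mathrm{L}_{g_{p,i}}V_p(x)\big)^2,$$ and $$\varphi(a,b):=\begin{cases}\dfrac{a+\sqrt{a^2+b^2}}{b}&\text{if }b\ne0,\\ 0&\text{otherwise,}\end{cases}$$ renders the closed-loop system $\dot x=f_\sigma(x)+\sum_{i=1}^m g_{\sigma,i}(x)k_{\sigma,i}(x)$, $x(0)=x_0$, $t\ge0$, globally asymptotically stable almost surely.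
   Context: $\|\cdot\|$ is the Euclidean norm, $\mathbb{R}_{\ge 0}=[0,\infty[$, $\mathbb{N}=\{1,2,\ldots\}$, and $0^0=1$. A continuous function $\alpha:\mathbb{R}_{\ge0}\to\mathbb{R}_{\ge0}$ is of class $\mathcal{K}$ if it is strictly increasing with $\alpha(0)=0$, and of class $\mathcal{K}_\infty$ if in addition $\alpha(r)\to\infty$ as $r\to\infty$. $\mathrm{L}_fV(x)=\frac{\partial V}{\partial x}(x)f(x)$ denotes the Lie derivative of $V$ along the vector field $f$. Setting: $\mathcal{P}=\{1,\ldots,\mathrm{N}\}$ is a finite index set; $f_p$ and $g_{p,i}$ are smooth vector fields on $\mathbb{R}^n$ with $f_p(0)=0$ and $g_{p,i}(0)=0$ for each $p\in\mathcal{P}$, $i\in\{1,\ldots,m\}$; the control inputs $u_i$ take values in $\mathbb{R}$. $(\Omega,\mathfrak{F},(\mathfrak{F}_t)_{t\ge0},\mathsf{P})$ is a complete filtered probability space, and $(\mathfrak{F}_t)$ is the natural filtration (satisfying the usual conditions) generated by a càdlàg random process $\sigma$ taking values in $\mathcal{P}$ (the switching signal). The value $\sigma(t)$ is perfectly known to the controller at each $t$. The switching instants are the discontinuity times of $\sigma$; the state $x$ has no jumps there. $N_\sigma(t)$ is the number of switches of $\sigma$ on the interval $]0,t]$. The initial state $x_0\in\mathbb{R}^n$, $x_0\ne0$, is deterministic. Solutions are understood in the sense of Carathéodory. A randomly switched system is globally asymptotically stable almost surely if both of the following hold, where $x(\cdot)$ is the solution from initial condition $x_0$ and the implications are for all initial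 conditions $x_0$: (SP1) $\mathsf{P}\big(\forall\varepsilon>0\ \exists\delta>0:\ \|x_0\|<\delta\Rightarrow \sup_{t\ge0}\|x(t)\|<\varepsilon\big)=1$; (SP2) $\mathsf{P}\big(\forall r,\varepsilon'>0\ \exists T\ge0:\ \|x_0\|<r\Rightarrow\sup_{t\ge T}\|x(t)\|<\varepsilon'\big)=1$. *)

theory Defs
  imports "HOL-Probability.Probability"
begin

subsection \<open>Regularity and comparison functions\<close>

text \<open>\<open>k\<close> times continuously differentiable on the whole space, by iterated partial derivatives.\<close>

primrec C_k :: "nat \<Rightarrow> ('a::euclidean_space \<Rightarrow> 'b::real_normed_vector) \<Rightarrow> bool" where
  "C_k 0 h \<longleftrightarrow> continuous_on UNIV h"
| "C_k (Suc k) h \<longleftrightarrow>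
     (\<forall>x. h differentiable (at x)) \<and>
     (\<forall>b\<in>Basis. C_k k (\<lambda>x. frechet_derivative h (at x) b))"

definition smooth :: "('a::euclidean_space \<Rightarrow> 'b::real_normed_vector) \<Rightarrow> bool" where
  "smooth h \<longleftrightarrow> (\<forall>k. C_k k h)"

text \<open>Only the values on \<open>[0, \<infinity>)\<close> matter; they are nonnegative by monotonicity and \<open>\<alpha> 0 = 0\<close>.\<close>

definition class_K :: "(real \<Rightarrow> real) \<Rightarrow> bool" where
  "class_K \<alpha> \<longleftrightarrow> continuous_on {0..} \<alpha> \<and> strict_mono_on {0..} \<alpha> \<and> \<alpha> 0 = 0"

definition class_K_inf :: "(real \<Rightarrow> real) \<Rightarrow> bool" where
  "class_K_inf \<alpha> \<longleftrightarrow> class_K \<alpha> \<and> filterlim \<alpha> at_top at_top"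

definition lie_derivative ::
  "('a::real_normed_vector \<Rightarrow> 'a) \<Rightarrow> ('a \<Rightarrow> real) \<Rightarrow> 'a \<Rightarrow> real" where
  "lie_derivative h V x = frechet_derivative V (at x) (h x)"


subsection \<open>Switching signals\<close>

text \<open>Continuity and limits are those of the discrete topology on \<^typ>\<open>nat\<close>.\<close>

definition cadlag :: "(real \<Rightarrow> nat) \<Rightarrow> bool" where
  "cadlag s \<longleftrightarrow>
     (\<forall>t\<ge>0. continuous (at_right t) s) \<and> (\<forall>t>0. \<exists>l. (s \<longlongrightarrow> l) (at_left t))"

definition switching_signal :: "'w measure \<Rightarrow> nat \<Rightarrow> (real \<Rightarrow> 'w \<Rightarrow> nat) \<Rightarrow> bool" where
  "switching_signal M N \<sigma> \<longleftrightarrow>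
     (\<forall>t\<ge>0. \<sigma> t \<in> M \<rightarrow>\<^sub>M count_space {1..N}) \<and>
     (\<forall>\<omega>\<in>space M. cadlag (\<lambda>t. \<sigma> t \<omega>))"

definition num_switches :: "(real \<Rightarrow> 'w \<Rightarrow> nat) \<Rightarrow> real \<Rightarrow> 'w \<Rightarrow> nat" where
  "num_switches \<sigma> t \<omega> = card {s \<in> {0<..t}. \<not> isCont (\<lambda>r. \<sigma> r \<omega>) s}"

definition natural_sigma_algebra :: "'w measure \<Rightarrow> (real \<Rightarrow> 'w \<Rightarrow> nat) \<Rightarrow> real \<Rightarrow> 'w set set" where
  "natural_sigma_algebra M \<sigma> t =
     sigma_sets (space M)
       (null_sets M \<union> {\<sigma> s -` A \<inter> space M | s A. 0 \<le> s \<and> s \<le> t})"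

text \<open>The usual augmentation (null sets added, right-continuous) of the filtration generated
  by \<open>\<sigma>\<close>. The values of \<open>\<F>\<close> at negative times are irrelevant.\<close>

definition is_natural_filtration ::
  "'w measure \<Rightarrow> (real \<Rightarrow> 'w \<Rightarrow> nat) \<Rightarrow> (real \<Rightarrow> 'w measure) \<Rightarrow> bool" where
  "is_natural_filtration M \<sigma> \<F> \<longleftrightarrow>
     (\<forall>t\<ge>0. space (\<F> t) = space M \<and>
             sets (\<F> t) = (\<Inter>s\<in>{t<..}. natural_sigma_algebra M \<sigma> s))"


subsection \<open>Caratheodory solutions and stability\<close>

definition abs_continuous_on :: "real \<Rightarrow> real \<Rightarrow> (real \<Rightarrow> 'a::real_normed_vector) \<Rightarrow> bool" where
  "abs_continuous_on a b x \<longleftrightarrow>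
     (\<forall>\<epsilon>>0. \<exists>\<delta>>0. \<forall>D. D division_of \<Union>D \<and> \<Union>D \<subseteq> {a..b} \<and> (\<Sum>I\<in>D. Sup I - Inf I) < \<delta>
        \<longrightarrow> (\<Sum>I\<in>D. norm (x (Sup I) - x (Inf I))) < \<epsilon>)"

definition caratheodory_solution ::
  "(real \<Rightarrow> 'a::real_normed_vector \<Rightarrow> 'a) \<Rightarrow> 'a \<Rightarrow> (real \<Rightarrow> 'a) \<Rightarrow> bool" where
  "caratheodory_solution F x0 x \<longleftrightarrow>
     x 0 = x0 \<and>
     (\<forall>T\<ge>0. abs_continuous_on 0 T x) \<and>
     (AE t in lebesgue. 0 < t \<longrightarrow> (x has_vector_derivative F t (x t)) (at t))"

definition switched_solution ::
  "(nat \<Rightarrow> 'a::real_normed_vector \<Rightarrow> 'a) \<Rightarrow> (real \<Rightarrow> 'w \<Rightarrow> nat) \<Rightarrow> 'w \<Rightarrow> 'a \<Rightarrow> (real \<Rightarrow> 'a) \<Rightarrow> bool" where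
  "switched_solution F \<sigma> \<omega> x0 x \<longleftrightarrow> caratheodory_solution (\<lambda>t. F (\<sigma> t \<omega>)) x0 x"

text \<open>The right-hand sides considered here are continuous in the state but need not be locally
  Lipschitz, so solutions need not be unique: global solutions are required to exist from every
  initial state, and the stability properties are required of all of them. The suprema are taken
  in \<^typ>\<open>ereal\<close>, so that they are infinite for unbounded trajectories.\<close>

definition gas_almost_surely ::
  "'w measure \<Rightarrow> (real \<Rightarrow> 'w \<Rightarrow> nat) \<Rightarrow> (nat \<Rightarrow> 'a::real_normed_vector \<Rightarrow> 'a) \<Rightarrow> bool" where
  "gas_almost_surely M \<sigma> F \<longleftrightarrow>
     \<P>(\<omega> in M. \<forall>x0. \<exists>x. switched_solution F \<sigma> \<omega> x0 x) = 1 \<and>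
     \<P>(\<omega> in M. \<forall>\<epsilon>>0. \<exists>\<delta>>0. \<forall>x0 x. switched_solution F \<sigma> \<omega> x0 x \<longrightarrow>
        norm x0 < \<delta> \<longrightarrow> (SUP t\<in>{0..}. ereal (norm (x t))) < ereal \<epsilon>) = 1 \<and>
     \<P>(\<omega> in M. \<forall>r>0. \<forall>\<epsilon>'>0. \<exists>T\<ge>0. \<forall>x0 x. switched_solution F \<sigma> \<omega> x0 x \<longrightarrow>
        norm x0 < r \<longrightarrow> (SUP t\<in>{T..}. ereal (norm (x t))) < ereal \<epsilon>') = 1"


subsection \<open>Control-affine systems and the universal feedback\<close>

definition control_affine ::
  "(nat \<Rightarrow> 'a::real_vector \<Rightarrow> 'a) \<Rightarrow> (nat \<Rightarrow> 'm::finite \<Rightarrow> 'a \<Rightarrow> 'a) \<Rightarrow> nat \<Rightarrow> real ^ 'm \<Rightarrow> 'a \<Rightarrow> 'a" where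
  "control_affine f g p u x = f p x + (\<Sum>i\<in>UNIV. (u $ i) *\<^sub>R g p i x)"

definition \<phi> :: "real \<Rightarrow> real \<Rightarrow> real" where
  "\<phi> a b = (if b \<noteq> 0 then (a + sqrt (a\<^sup>2 + b\<^sup>2)) / b else 0)"

definition W_bar ::
  "(nat \<Rightarrow> 'a::real_normed_vector \<Rightarrow> 'a) \<Rightarrow> (nat \<Rightarrow> 'a \<Rightarrow> real) \<Rightarrow> real \<Rightarrow> nat \<Rightarrow> 'a \<Rightarrow> real" where
  "W_bar f V lam0 p x = lie_derivative (f p) (V p) x + lam0 * V p x"

definition W_tilde ::
  "(nat \<Rightarrow> 'm::finite \<Rightarrow> 'a::real_normed_vector \<Rightarrow> 'a) \<Rightarrow> (nat \<Rightarrow> 'a \<Rightarrow> real) \<Rightarrow> nat \<Rightarrow> 'a \<Rightarrow> real" where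
  "W_tilde g V p x = (\<Sum>i\<in>UNIV. (lie_derivative (g p i) (V p) x)\<^sup>2)"

definition universal_feedback ::
  "(nat \<Rightarrow> 'a::real_normed_vector \<Rightarrow> 'a) \<Rightarrow> (nat \<Rightarrow> 'm::finite \<Rightarrow> 'a \<Rightarrow> 'a) \<Rightarrow>
   (nat \<Rightarrow> 'a \<Rightarrow> real) \<Rightarrow> real \<Rightarrow> nat \<Rightarrow> 'a \<Rightarrow> real ^ 'm" where
  "universal_feedback f g V lam0 p x =
     (\<chi> i. - lie_derivative (g p i) (V p) x * \<phi> (W_bar f V lam0 p x) (W_tilde g V p x))"

end

theory Submission
  imports Defs "HOL-Complex_Analysis.Great_Picard"
begin

text \<open>
The feedback makes every Lyapunov function \<open>V p\<close> decay at rate \<open>lam0\<close> along mode \<open>p\<close> of the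
closed loop (\<open>closed_loop_dissipation\<close>), while a switch costs at most a factor \<open>\<mu>\<close>. For
every path of the switching signal, hence, with \<open>N t\<close> the number of switches up to time
\<open>t\<close>, every solution satisfies

  \<open>\<alpha>\<^sub>1 (norm (x t)) \<le> \<mu> ^ N t * exp (- lam0 * t) * \<alpha>\<^sub>2 (norm x0)\<close>

(\<open>switched_decay\<close>). The weight \<open>\<mu> ^ N t * exp (- lam0 * t)\<close> is independent of the
solution. Summing the bounds on the law of \<open>N t\<close> shows that its expectation is at most
\<open>C * exp (- lam0 * t) + exp ((\<mu> * lam_bar - lam_tilde - lam0) * t)\<close>, which decays
exponentially because \<open>\<mu> < (lam0 + lam_tilde) / lam_bar\<close>. The expectations at integer
times are therefore summable, and almost surely the weight tends to zero along the integers
(\<open>AE_switching_weight_tendsto_zero\<close>); by monotonicity of \<open>N\<close> it is bounded and tends to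
zero in continuous time (\<open>switching_weight_bounds\<close>). Boundedness gives stability and
convergence to zero gives attraction, both uniformly in the solution.

Three points need work. The solutions are absolutely continuous curves satisfying the equation
almost everywhere, so monotonicity of the Lyapunov functions along them rests on the fact that an
absolutely continuous function with nonpositive derivative almost everywhere is nonincreasing
(\<open>abs_continuous_nonincreasing\<close>). The feedback is continuous but not Lipschitz, because \<open>V p\<close>
is only continuously differentiable, so global solutions come from a compactness argument
(\<open>caratheodory_existence\<close>) combined with the Lyapunov estimate as an a priori bound
(\<open>switched_solution_exists\<close>). And \<open>N t\<close> must be shown to be a random variable
(\<open>measurable_num_switches\<close>).
\<close>

section \<open>Absolutely continuous functions and decay along curves\<close>

text \<open>Connects the lengths in the definition of absolute continuity with Lebesgue measure: the members
of a division overlap only in endpoints, so their lengths add up to the measure of the union.\<close>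

lemma division_total_length_le_measure:
  fixes D :: "real set set"
  assumes D: "D division_of \<Union>D" and sub: "\<Union>D \<subseteq> U" and U: "U \<in> lmeasurable"
  shows "(\<Sum>I\<in>D. Sup I - Inf I) \<le> measure lebesgue U"
proof -
  have fin: "finite D" using D by auto
  have int: "\<exists>a b. K = {a..b} \<and> a \<le> b" if "K \<in> D" for K
    using division_ofD[OF D] that by (metis atLeastatMost_empty_iff box_real(2))
  have len: "Sup K - Inf K = measure lebesgue K" if "K \<in> D" for K
    using int[OF that] by auto
  have lm: "K \<in> lmeasurable" if "K \<in> D" for K
    using int[OF that] by auto
  have "(\<Sum>I\<in>D. Sup I - Inf I) = (\<Sum>I\<in>D. measure lebesgue I)"
    using len by simp
  also have "\<dots> = measure lebesgue (\<Union>D)"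
  proof (rule measure_negligible_finite_Union[symmetric])
    show "pairwise (\<lambda>S T. negligible (S \<inter> T)) D"
    proof (rule pairwiseI)
      fix S T assume "S \<in> D" "T \<in> D" "S \<noteq> T"
      then have "interior S \<inter> interior T = {}" using division_ofD(5)[OF D] by blast
      moreover obtain a b c d where "S = {a..b}" "T = {c..d}" using int \<open>S \<in> D\<close> \<open>T \<in> D\<close> by meson
      ultimately have "interior (S \<inter> T) = {}" "S \<inter> T = {max a c..min b d}" by auto
      then show "negligible (S \<inter> T)"
        using negligible_interval(1)[of "max a c" "min b d"] by (simp add: interior_cbox)
    qed
  qed (use fin lm in auto)
  also have "\<dots> \<le> measure lebesgue U"
    using sub fin lm U by (intro measure_mono_fmeasurable) auto
  finally show ?thesis .
qed

text \<open>Cousin's lemma turns local monotonicity into global monotonicity: a tagged division fine for the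
gauge of local radii makes the increments telescope, and each of them is nonpositive. Only pairs
straddling the tag are compared, so left and right neighbourhoods may be treated separately; this
is what makes the lemma apply at a jump.\<close>

lemma locally_decreasing_imp_le:
  fixes h :: "real \<Rightarrow> real"
  assumes "a \<le> b"
    and loc: "\<And>t. t \<in> {a..b} \<Longrightarrow> \<exists>d>0. \<forall>u v. a \<le> u \<longrightarrow> u \<le> t \<longrightarrow> t \<le> v \<longrightarrow> v \<le> b \<longrightarrow> t - d < u \<longrightarrow> v < t + d \<longrightarrow> h v \<le> h u"
  shows "h b \<le> h a"
proof -
  obtain d where d: "\<And>t. t \<in> {a..b} \<Longrightarrow> d t > 0"
    and dh: "\<And>t u v. t \<in> {a..b} \<Longrightarrow> a \<le> u \<Longrightarrow> u \<le> t \<Longrightarrow> t \<le> v \<Longrightarrow> v \<le> b \<Longrightarrow> t - d t < u \<Longrightarrow> v < t + d t \<Longrightarrow> h v \<le> h u"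
    using loc by metis
  define g where "g t = ball t (if t \<in> {a..b} then d t else 1)" for t
  have "gauge g" unfolding gauge_def g_def using d by auto
  then obtain p where p: "p tagged_division_of {a..b}" "g fine p"
    using fine_division_exists_real by blast
  have "(\<Sum>(x,K)\<in>p. h (Sup K) - h (Inf K)) \<le> 0"
  proof (rule sum_nonpos, clarify)
    fix t K assume tK: "(t, K) \<in> p"
    then have K: "t \<in> K" "K \<subseteq> {a..b}" "K \<subseteq> g t"
      using tagged_division_ofD[OF p(1)] p(2) by (auto simp: fine_def)
    obtain u v where uv: "K = {u..v}" using tagged_division_ofD(4)[OF p(1) tK] by auto
    then have "u \<in> K" "v \<in> K" "u \<le> t" "t \<le> v" using K by auto
    then have "h v \<le> h u"
      using K by (intro dh[of t]) (auto simp: g_def dist_real_def subset_iff split: if_splits)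
    then show "h (Sup K) - h (Inf K) \<le> 0" using uv K by auto
  qed
  then show ?thesis using additive_tagged_division_1[OF assms(1) p(1), of h] by simp
qed

text \<open>A gauge replaces the fundamental theorem of calculus for absolutely continuous functions. Where
the derivative exists and is nonpositive, the gauge makes increments over short intervals around the point at most
\<open>\<epsilon>\<close> times their length. The exceptional null set is covered by an open set \<open>U\<close> of
measure below the modulus of absolute continuity, and the intervals tagged there stay inside
\<open>U\<close>, so together they contribute at most \<open>\<epsilon>\<close>.\<close>

lemma abs_continuous_nonincreasing:
  fixes h :: "real \<Rightarrow> real"
  assumes ab: "a \<le> b" and ac: "abs_continuous_on a b h"
    and der: "AE t in lebesgue. a < t \<and> t < b \<longrightarrow> (\<exists>D\<le>0. (h has_real_derivative D) (at t))"
  shows "h b \<le> h a"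
proof -
  define E where "E = {t. \<not> (a < t \<and> t < b \<longrightarrow> (\<exists>D\<le>0. (h has_real_derivative D) (at t)))} \<union> {a, b}"
  have "negligible E"
  proof -
    obtain Z where "Z \<in> null_sets lebesgue" "{t. \<not> (a < t \<and> t < b \<longrightarrow> (\<exists>D\<le>0. (h has_real_derivative D) (at t)))} \<subseteq> Z"
      using der unfolding eventually_ae_filter by auto
    then show ?thesis
      unfolding E_def by (meson negligible_Un negligible_iff_null_sets negligible_subset finite.emptyI finite_insert negligible_finite)
  qed
  have "h b - h a \<le> e" if e: "e > 0" for e
  proof -
    \<comment> \<open>One share of \<open>\<epsilon>\<close> for the exceptional set, \<open>b - a\<close> shares for the rest.\<close>
    define \<epsilon> where "\<epsilon> = e / (1 + (b - a))"
    have eps: "\<epsilon> > 0" using e ab by (simp add: \<epsilon>_def)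
    obtain \<delta> where \<delta>: "\<delta> > 0" and acd: "\<And>D. D division_of \<Union>D \<Longrightarrow> \<Union>D \<subseteq> {a..b} \<Longrightarrow> (\<Sum>I\<in>D. Sup I - Inf I) < \<delta>
        \<Longrightarrow> (\<Sum>I\<in>D. norm (h (Sup I) - h (Inf I))) < \<epsilon>"
      using ac eps unfolding abs_continuous_on_def by meson
    obtain U where U: "open U" "E \<subseteq> U" "U \<in> lmeasurable" "measure lebesgue U < \<delta>"
    proof -
      have E: "E \<in> lmeasurable" "measure lebesgue E = 0"
        using \<open>negligible E\<close> negligible_imp_measurable negligible_imp_measure0 by auto
      then obtain T where T: "open T" "E \<subseteq> T" "(T - E) \<in> lmeasurable" "emeasure lebesgue (T - E) < ennreal \<delta>"
        using \<delta> sets_lebesgue_outer_open[of E \<delta>] by blast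
      have TE: "T = (T - E) \<union> E" using T by auto
      have "measure lebesgue (T - E) < \<delta>"
        using T(3,4) \<delta> by (simp add: emeasure_eq_measure2 ennreal_less_iff)
      moreover have "measure lebesgue T \<le> measure lebesgue (T - E) + measure lebesgue E"
        using T(3) E(1) by (subst TE, intro measure_Un_le) (auto simp: fmeasurable_def)
      moreover have "T \<in> lmeasurable" using T(3) E(1) TE by (metis fmeasurable.Un)
      ultimately show ?thesis using T E that by auto
    qed
    have "\<exists>d>0. \<forall>u v. t - d < u \<longrightarrow> u \<le> t \<longrightarrow> t \<le> v \<longrightarrow> v < t + d \<longrightarrow> h v - h u \<le> \<epsilon> * (v - u)" if "t \<in> {a..b} - E" for t
    proof -
      obtain D where D: "D \<le> 0" "(h has_real_derivative D) (at t)"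
      proof -
        have "t \<noteq> a" "t \<noteq> b" "a < t \<and> t < b \<longrightarrow> (\<exists>D\<le>0. (h has_real_derivative D) (at t))"
          using \<open>t \<in> {a..b} - E\<close> unfolding E_def by blast+
        then show ?thesis using \<open>t \<in> {a..b} - E\<close> that by fastforce
      qed
      then have "(h has_derivative (\<lambda>x. D * x)) (at t)" by (simp add: has_field_derivative_def)
      then obtain d where d: "d > 0" "\<And>y. norm (y - t) < d \<Longrightarrow> norm (h y - h t - D * (y - t)) \<le> \<epsilon> * norm (y - t)"
        using eps unfolding has_derivative_at_alt by blast
      have "h v - h u \<le> \<epsilon> * (v - u)" if "t - d < u" "u \<le> t" "t \<le> v" "v < t + d" for u v
      proof -
        have "h v - h t - D * (v - t) \<le> \<epsilon> * (v - t)" using d(2)[of v] that by (simp add: abs_le_iff)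
        moreover have "-(h u - h t - D * (u - t)) \<le> \<epsilon> * (t - u)" using d(2)[of u] that by (simp add: abs_le_iff)
        moreover have "D * (v - u) \<le> 0" using D that by (simp add: mult_nonpos_nonneg)
        ultimately show ?thesis by (simp add: algebra_simps)
      qed
      then show ?thesis using d(1) by blast
    qed
    then obtain d where d: "\<And>t. t \<in> {a..b} - E \<Longrightarrow> d t > 0"
      and dh: "\<And>t u v. t \<in> {a..b} - E \<Longrightarrow> t - d t < u \<Longrightarrow> u \<le> t \<Longrightarrow> t \<le> v \<Longrightarrow> v < t + d t \<Longrightarrow> h v - h u \<le> \<epsilon> * (v - u)"
      by metis
    define g where "g t = (if t \<in> E then U else ball t (if t \<in> {a..b} then d t else 1))" for t
    have "gauge g" unfolding gauge_def g_def using d U by auto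
    then obtain p where p: "p tagged_division_of {a..b}" "g fine p"
      using fine_division_exists_real by blast
    have finp: "finite p" using p by auto
    have Kp: "\<exists>u v. K = {u..v} \<and> u \<le> t \<and> t \<le> v \<and> u \<in> g t \<and> v \<in> g t \<and> t \<in> {a..b} \<and> K \<subseteq> g t" if tK: "(t,K) \<in> p" for t K
    proof -
      have K: "t \<in> K" "K \<subseteq> {a..b}" "K \<subseteq> g t"
        using tagged_division_ofD[OF p(1)] p(2) that by (auto simp: fine_def)
      obtain u v where uv: "K = {u..v}" using tagged_division_ofD(4)[OF p(1) tK] by auto
      show ?thesis using K uv by (intro exI[of _ u] exI[of _ v]) auto
    qed
    define q where "q = {(t,K) \<in> p. t \<in> E}"
    have q: "q tagged_partial_division_of {a..b}" "q \<subseteq> p"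
      using p(1) tagged_partial_division_subset[of p "{a..b}" q] by (auto simp: q_def tagged_division_of_def)
    let ?D = "snd ` q"
    have Dd: "?D division_of \<Union>?D" using partial_division_of_tagged_division[OF q(1)] .
    have "\<Union>?D \<subseteq> U"
    proof -
      have "K \<subseteq> U" if "(t,K) \<in> q" for t K
      proof -
        have "(t,K) \<in> p" "t \<in> E" using that by (auto simp: q_def)
        then have "K \<subseteq> g t" using Kp by blast
        then show ?thesis using \<open>t \<in> E\<close> by (simp add: g_def)
      qed
      then show ?thesis by (intro Union_least) (metis (no_types) imageE prod.collapse)
    qed
    then have "(\<Sum>I\<in>?D. Sup I - Inf I) < \<delta>"
      using division_total_length_le_measure[OF Dd _ U(3)] U(4) by force
    moreover have "\<Union>?D \<subseteq> {a..b}"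
    proof -
      have "K \<subseteq> {a..b}" if "(t,K) \<in> q" for t K using tagged_partial_division_ofD(3)[OF q(1) that] .
      then show ?thesis by (intro Union_least) (metis (no_types) imageE prod.collapse)
    qed
    ultimately have "(\<Sum>I\<in>?D. norm (h (Sup I) - h (Inf I))) < \<epsilon>" using acd Dd by blast
    moreover have "(\<Sum>(t,K)\<in>q. norm (h (Sup K) - h (Inf K))) = (\<Sum>I\<in>?D. norm (h (Sup I) - h (Inf I)))"
    proof -
      let ?d = "\<lambda>K. if K = {} then 0 else norm (h (Sup K) - h (Inf K))"
      have "(\<Sum>(t,K)\<in>q. ?d K) = (\<Sum>K\<in>?D. ?d K)"
        by (rule sum.over_tagged_division_lemma[OF tagged_partial_division_of_Union_self[OF q(1)]]) auto
      moreover have "K \<noteq> {}" if "(t,K) \<in> q" for t K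
        using that q(1) by (auto simp: tagged_partial_division_of_def)
      then have "(\<Sum>(t,K)\<in>q. ?d K) = (\<Sum>(t,K)\<in>q. norm (h (Sup K) - h (Inf K)))"
        "(\<Sum>K\<in>?D. ?d K) = (\<Sum>I\<in>?D. norm (h (Sup I) - h (Inf I)))"
        by (auto intro!: sum.cong)
      ultimately show ?thesis by simp
    qed
    moreover have "(\<Sum>(t,K)\<in>q. h (Sup K) - h (Inf K)) \<le> (\<Sum>(t,K)\<in>q. norm (h (Sup K) - h (Inf K)))"
      by (intro sum_mono) auto
    ultimately have 1: "(\<Sum>(t,K)\<in>q. h (Sup K) - h (Inf K)) \<le> \<epsilon>" by linarith
    have "(\<Sum>(t,K)\<in>p - q. h (Sup K) - h (Inf K)) \<le> (\<Sum>(t,K)\<in>p - q. \<epsilon> * (Sup K - Inf K))"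
    proof (intro sum_mono, clarify)
      fix t K assume tK: "(t, K) \<in> p" "(t, K) \<notin> q"
      then obtain u v where uv: "K = {u..v}" "u \<le> t" "t \<le> v" "u \<in> g t" "v \<in> g t" "t \<in> {a..b}" using Kp by blast
      moreover have "t \<notin> E" using tK by (auto simp: q_def)
      ultimately have "h v - h u \<le> \<epsilon> * (v - u)"
        by (intro dh[of t]) (auto simp: g_def dist_real_def)
      then show "h (Sup K) - h (Inf K) \<le> \<epsilon> * (Sup K - Inf K)" using uv by auto
    qed
    also have "\<dots> \<le> (\<Sum>(t,K)\<in>p. \<epsilon> * (Sup K - Inf K))"
    proof (rule sum_mono2[OF finp])
      fix z assume "z \<in> p - (p - q)"
      then obtain t K where z: "z = (t,K)" "(t,K) \<in> p" by (cases z) auto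
      from Kp[OF z(2)] show "0 \<le> (case z of (t, K) \<Rightarrow> \<epsilon> * (Sup K - Inf K))" using eps z by auto
    qed auto
    also have "\<dots> = \<epsilon> * (b - a)"
      using additive_tagged_division_1[OF ab p(1), of "\<lambda>x. \<epsilon> * x"] by (simp add: algebra_simps)
    finally have 2: "(\<Sum>(t,K)\<in>p - q. h (Sup K) - h (Inf K)) \<le> \<epsilon> * (b - a)" .
    have "h b - h a = (\<Sum>(t,K)\<in>p. h (Sup K) - h (Inf K))"
      using additive_tagged_division_1[OF ab p(1), of h] by simp
    also have "\<dots> = (\<Sum>(t,K)\<in>p - q. h (Sup K) - h (Inf K)) + (\<Sum>(t,K)\<in>q. h (Sup K) - h (Inf K))"
      using sum.subset_diff[OF q(2) finp] by blast
    also have "\<dots> \<le> \<epsilon> * (1 + (b - a))" using 1 2 by (simp add: algebra_simps)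
    also have "\<dots> = e" using ab by (simp add: \<epsilon>_def)
    finally show ?thesis .
  qed
  then show ?thesis by (metis diff_le_eq add.commute field_le_epsilon)
qed

lemma abs_continuous_on_subset:
  assumes "abs_continuous_on a b x" "a \<le> c" "d \<le> b"
  shows "abs_continuous_on c d x"
proof -
  have "{c..d} \<subseteq> {a..b}" using assms by auto
  then show ?thesis using assms(1) unfolding abs_continuous_on_def by (meson order_trans)
qed

lemma abs_continuous_on_imp_continuous_on:
  assumes "abs_continuous_on a b x"
  shows "continuous_on {a..b} x"
  unfolding continuous_on_iff
proof (intro ballI allI impI)
  fix s e :: real assume s: "s \<in> {a..b}" and e: "0 < e"
  obtain \<delta> where \<delta>: "\<delta> > 0" and ac: "\<And>D. D division_of \<Union>D \<Longrightarrow> \<Union>D \<subseteq> {a..b} \<Longrightarrow> (\<Sum>I\<in>D. Sup I - Inf I) < \<delta>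
        \<Longrightarrow> (\<Sum>I\<in>D. norm (x (Sup I) - x (Inf I))) < e"
    using assms e unfolding abs_continuous_on_def by meson
  have *: "norm (x v - x u) < e" if "u \<in> {a..b}" "v \<in> {a..b}" "u \<le> v" "v - u < \<delta>" for u v
  proof -
    have "{{u..v}} division_of \<Union>{{u..v}}" using that division_of_self[of u v] by (auto simp: cbox_interval)
    then show ?thesis using ac[of "{{u..v}}"] that by auto
  qed
  show "\<exists>d>0. \<forall>t\<in>{a..b}. dist t s < d \<longrightarrow> dist (x t) (x s) < e"
  proof (intro exI[of _ \<delta>] conjI ballI impI \<delta>)
    fix t assume "t \<in> {a..b}" "dist t s < \<delta>"
    then show "dist (x t) (x s) < e"
      using *[of s t] *[of t s] s by (cases "s \<le> t") (auto simp: dist_norm norm_minus_commute)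
  qed
qed

text \<open>Absolute continuity passes to any function whose increments are dominated by those of time and of
an absolutely continuous curve. It covers Lipschitz functions (take the curve constant) and
functions of \<open>(t, x t)\<close> that are Lipschitz on bounded sets.\<close>

lemma abs_continuous_on_transfer:
  fixes x :: "real \<Rightarrow> 'a::real_normed_vector" and h :: "real \<Rightarrow> 'b::real_normed_vector"
  assumes ac: "abs_continuous_on a b x" and K: "K > 0"
    and lip: "\<And>s t. s \<in> {a..b} \<Longrightarrow> t \<in> {a..b} \<Longrightarrow> norm (h t - h s) \<le> K * (\<bar>t - s\<bar> + norm (x t - x s))"
  shows "abs_continuous_on a b h"
  unfolding abs_continuous_on_def
proof (intro allI impI)
  fix e :: real assume e: "e > 0"
  then have e2: "e / (2 * K) > 0" using K by simp
  then obtain \<delta> where \<delta>: "\<delta> > 0" and ac: "\<And>D. D division_of \<Union>D \<Longrightarrow> \<Union>D \<subseteq> {a..b} \<Longrightarrow> (\<Sum>I\<in>D. Sup I - Inf I) < \<delta>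
        \<Longrightarrow> (\<Sum>I\<in>D. norm (x (Sup I) - x (Inf I))) < e / (2 * K)"
    using ac unfolding abs_continuous_on_def by meson
  show "\<exists>\<delta>>0. \<forall>D. D division_of \<Union>D \<and> \<Union>D \<subseteq> {a..b} \<and> (\<Sum>I\<in>D. Sup I - Inf I) < \<delta>
        \<longrightarrow> (\<Sum>I\<in>D. norm (h (Sup I) - h (Inf I))) < e"
  proof (rule exI[of _ "min \<delta> (e / (2 * K))"], intro conjI allI impI)
    show "0 < min \<delta> (e / (2 * K))" using \<delta> e2 by simp
    fix D :: "real set set" assume D: "D division_of \<Union>D \<and> \<Union>D \<subseteq> {a..b} \<and> (\<Sum>I\<in>D. Sup I - Inf I) < min \<delta> (e / (2 * K))"
    have "norm (h (Sup I) - h (Inf I)) \<le> K * ((Sup I - Inf I) + norm (x (Sup I) - x (Inf I)))" if ID: "I \<in> D" for I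
    proof -
      obtain u v where uv: "I = {u..v}" "u \<le> v"
        using division_ofD(3,4)[of D "\<Union>D" I] D ID by (metis atLeastatMost_empty_iff box_real(2))
      have "I \<subseteq> {a..b}" using D that by blast
      then show ?thesis using uv lip[of u v] by auto
    qed
    then have "(\<Sum>I\<in>D. norm (h (Sup I) - h (Inf I))) \<le> (\<Sum>I\<in>D. K * ((Sup I - Inf I) + norm (x (Sup I) - x (Inf I))))"
      by (rule sum_mono)
    also have "\<dots> = K * ((\<Sum>I\<in>D. Sup I - Inf I) + (\<Sum>I\<in>D. norm (x (Sup I) - x (Inf I))))"
      by (simp only: sum.distrib sum_distrib_left[symmetric])
    also have "\<dots> < K * (e / (2 * K) + e / (2 * K))"
      using D ac[of D] K by (intro mult_strict_left_mono add_strict_mono) auto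
    also have "\<dots> = e" using K by (simp add: field_simps)
    finally show "(\<Sum>I\<in>D. norm (h (Sup I) - h (Inf I))) < e" .
  qed
qed

lemma lipschitz_imp_abs_continuous_on:
  fixes x :: "real \<Rightarrow> 'a::real_normed_vector"
  assumes "\<And>s t. s \<in> {a..b} \<Longrightarrow> t \<in> {a..b} \<Longrightarrow> norm (x t - x s) \<le> L * \<bar>t - s\<bar>"
  shows "abs_continuous_on a b x"
proof (rule abs_continuous_on_transfer)
  show "abs_continuous_on a b (\<lambda>_. 0 :: real)"
    unfolding abs_continuous_on_def by (auto intro: exI[of _ 1])
  show "max L 1 > 0" by simp
  fix s t assume "s \<in> {a..b}" "t \<in> {a..b}"
  then show "norm (x t - x s) \<le> max L 1 * (\<bar>t - s\<bar> + norm (0 - 0 :: real))"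
    by (intro order_trans[OF assms]) (auto intro: mult_right_mono)
qed

lemma C1_has_derivative:
  assumes "C_k 1 V"
  shows "(V has_derivative frechet_derivative V (at x)) (at x)"
  using assms unfolding One_nat_def C_k.simps frechet_derivative_works by blast

text \<open>The hypothesis \<^term>\<open>C_k 1\<close> expresses continuity of the derivative only through partial
derivatives; linearity transfers it to every direction.\<close>

lemma C1_derivative_expand:
  fixes V :: "'a::euclidean_space \<Rightarrow> real"
  assumes "C_k 1 V"
  shows "frechet_derivative V (at x) v = (\<Sum>b\<in>Basis. (v \<bullet> b) * frechet_derivative V (at x) b)"
proof -
  have "linear (frechet_derivative V (at x))"
    using C1_has_derivative[OF assms] has_derivative_linear by blast
  then show ?thesis
    using Linear_Algebra.linear_componentwise[of "frechet_derivative V (at x)" v 1] by simp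
qed

lemma C1_continuous_derivative:
  fixes V :: "'a::euclidean_space \<Rightarrow> real"
  assumes "C_k 1 V" and "continuous_on S F"
  shows "continuous_on S (\<lambda>x. frechet_derivative V (at x) (F x))"
proof -
  have "continuous_on UNIV (\<lambda>x. frechet_derivative V (at x) b)" if "b \<in> Basis" for b
    using assms(1) that by simp
  then have "continuous_on S (\<lambda>x. frechet_derivative V (at x) b)" if "b \<in> Basis" for b
    using that continuous_on_subset by blast
  then show ?thesis
    by (subst C1_derivative_expand[OF assms(1)]) (intro continuous_intros assms(2))
qed

lemma C1_lipschitz_on_cball:
  fixes V :: "'a::euclidean_space \<Rightarrow> real"
  assumes V: "C_k 1 V"
  obtains L where "L \<ge> 0" "\<And>y z. norm y \<le> R \<Longrightarrow> norm z \<le> R \<Longrightarrow> \<bar>V y - V z\<bar> \<le> L * norm (y - z)"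
proof -
  have "\<exists>B. \<forall>y\<in>cball 0 R. \<bar>frechet_derivative V (at y) b\<bar> \<le> B" if "b \<in> Basis" for b
  proof -
    have "continuous_on (cball 0 R) (\<lambda>x. frechet_derivative V (at x) b)"
      by (rule C1_continuous_derivative[OF V continuous_on_const])
    then have "bounded ((\<lambda>x. frechet_derivative V (at x) b) ` cball 0 R)"
      by (intro compact_imp_bounded compact_continuous_image compact_cball)
    then show ?thesis unfolding bounded_iff by auto
  qed
  then obtain B where B: "\<And>b y. b \<in> Basis \<Longrightarrow> y \<in> cball 0 R \<Longrightarrow> \<bar>frechet_derivative V (at y) b\<bar> \<le> B b"
    by metis
  let ?L = "\<Sum>b\<in>Basis. \<bar>B b\<bar>"
  have on: "onorm (frechet_derivative V (at y)) \<le> ?L" if "y \<in> cball 0 R" for y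
  proof (rule onorm_bound)
    show "0 \<le> ?L" by (simp add: sum_nonneg)
    fix v :: 'a
    have "norm (frechet_derivative V (at y) v) \<le> (\<Sum>b\<in>Basis. \<bar>v \<bullet> b\<bar> * \<bar>frechet_derivative V (at y) b\<bar>)"
      by (subst C1_derivative_expand[OF V]) (metis (mono_tags, lifting) abs_mult real_norm_def sum_abs sum.cong)
    also have "\<dots> \<le> (\<Sum>b\<in>Basis. norm v * \<bar>B b\<bar>)"
      using order_trans[OF B[OF _ that] abs_ge_self]
      by (intro sum_mono mult_mono) (simp_all add: Basis_le_norm)
    also have "\<dots> = ?L * norm v" by (simp add: sum_distrib_left mult.commute)
    finally show "norm (frechet_derivative V (at y) v) \<le> ?L * norm v" .
  qed
  have "norm (V y - V z) \<le> ?L * norm (y - z)" if "norm y \<le> R" "norm z \<le> R" for y z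
    by (rule differentiable_bound[OF convex_cball, of 0 R _ "\<lambda>y. frechet_derivative V (at y)"])
       (use on that in \<open>auto intro: has_derivative_at_withinI C1_has_derivative[OF V]\<close>)
  then show ?thesis using that[of ?L] by (simp add: sum_nonneg)
qed

text \<open>The pathwise comparison argument on an interval with a fixed mode:
\<open>exp (lam * t) * V (x t)\<close> is absolutely continuous, since \<open>V\<close> is Lipschitz on the
bounded range of the curve, and its derivative is nonpositive almost everywhere.\<close>

lemma exponential_decay_along_curve:
  fixes V :: "'a::euclidean_space \<Rightarrow> real"
  assumes V: "C_k 1 V" and ab: "a \<le> b" and ac: "abs_continuous_on a b x"
    and der: "AE t in lebesgue. a < t \<and> t < b \<longrightarrow>
      (\<exists>w. (x has_vector_derivative w) (at t) \<and> frechet_derivative V (at (x t)) w \<le> - lam * V (x t))"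
  shows "exp (lam * b) * V (x b) \<le> exp (lam * a) * V (x a)"
proof (rule abs_continuous_nonincreasing[OF ab, of "\<lambda>t. exp (lam * t) * V (x t)"])
  have cx: "continuous_on {a..b} x" using abs_continuous_on_imp_continuous_on[OF ac] .
  then have "bounded (x ` {a..b})"
    by (intro compact_imp_bounded compact_continuous_image compact_Icc)
  then obtain R where R: "\<And>t. t \<in> {a..b} \<Longrightarrow> norm (x t) \<le> R" unfolding bounded_iff by (metis imageI)
  have aa: "a \<in> {a..b}" using ab by simp
  obtain L where L: "L \<ge> 0" "\<And>y z. norm y \<le> R \<Longrightarrow> norm z \<le> R \<Longrightarrow> \<bar>V y - V z\<bar> \<le> L * norm (y - z)"
    using C1_lipschitz_on_cball[OF V] by blast
  define c where "c = exp (\<bar>lam\<bar> * (\<bar>a\<bar> + \<bar>b\<bar>))"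
  have c: "exp (lam * t) \<le> c" if "t \<in> {a..b}" for t
  proof -
    have "lam * t \<le> \<bar>lam\<bar> * \<bar>t\<bar>" by (metis abs_ge_self abs_mult)
    also have "\<dots> \<le> \<bar>lam\<bar> * (\<bar>a\<bar> + \<bar>b\<bar>)" 
    proof (rule mult_left_mono)
      show "\<bar>t\<bar> \<le> \<bar>a\<bar> + \<bar>b\<bar>" using that unfolding atLeastAtMost_iff by linarith
    qed simp
    finally show ?thesis by (simp only: c_def exp_le_cancel_iff)
  qed
  have c0: "c > 0" unfolding c_def by (rule exp_gt_zero)
  have ed: "\<bar>exp (lam * t) - exp (lam * s)\<bar> \<le> (c * \<bar>lam\<bar>) * \<bar>t - s\<bar>" if "s \<in> {a..b}" "t \<in> {a..b}" for s t
  proof -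
    have "norm (exp (lam * t) - exp (lam * s)) \<le> (c * \<bar>lam\<bar>) * norm (t - s)"
    proof (rule field_differentiable_bound[of "{a..b}" _ "\<lambda>t. exp (lam * t) * lam"])
      show "((\<lambda>t. exp (lam * t)) has_field_derivative exp (lam * z) * lam) (at z within {a..b})" for z
        by (auto intro!: derivative_eq_intros)
      show "norm (exp (lam * z) * lam) \<le> c * \<bar>lam\<bar>" if "z \<in> {a..b}" for z
        using c[OF that] by (simp add: abs_mult mult_right_mono)
    qed (use that in auto)
    then show ?thesis by simp
  qed
  obtain C where C: "\<And>t. t \<in> {a..b} \<Longrightarrow> \<bar>V (x t)\<bar> \<le> C"
  proof -
    have "\<bar>V (x t)\<bar> \<le> \<bar>V (x a)\<bar> + L * (2 * R)" if "t \<in> {a..b}" for t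
    proof -
      have "norm (x t - x a) \<le> 2 * R" using R[OF that] R[OF aa] norm_triangle_ineq4[of "x t" "x a"] by simp
      then have "L * norm (x t - x a) \<le> L * (2 * R)" using L(1) by (rule mult_left_mono)
      then show ?thesis using L(2)[OF R[OF that] R[OF aa]] by linarith
    qed
    then show ?thesis using that by blast
  qed
  show "abs_continuous_on a b (\<lambda>t. exp (lam * t) * V (x t))"
  proof (rule abs_continuous_on_transfer[OF ac])
    show "c * \<bar>lam\<bar> * \<bar>C\<bar> + c * L + 1 > 0" using L(1) c0 by (simp add: add_nonneg_pos)
    fix s t assume st: "s \<in> {a..b}" "t \<in> {a..b}"
    have "exp (lam * t) * V (x t) - exp (lam * s) * V (x s)
       = (exp (lam * t) - exp (lam * s)) * V (x t) + exp (lam * s) * (V (x t) - V (x s))"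
      by (simp add: algebra_simps)
    also have "norm \<dots> \<le> \<bar>exp (lam * t) - exp (lam * s)\<bar> * \<bar>V (x t)\<bar> + exp (lam * s) * \<bar>V (x t) - V (x s)\<bar>"
      using norm_triangle_ineq[of "(exp (lam * t) - exp (lam * s)) * V (x t)" "exp (lam * s) * (V (x t) - V (x s))"]
      by (simp add: abs_mult)
    also have "\<dots> \<le> ((c * \<bar>lam\<bar>) * \<bar>t - s\<bar>) * \<bar>C\<bar> + c * (L * norm (x t - x s))"
    proof (rule add_mono)
      show "\<bar>exp (lam * t) - exp (lam * s)\<bar> * \<bar>V (x t)\<bar> \<le> ((c * \<bar>lam\<bar>) * \<bar>t - s\<bar>) * \<bar>C\<bar>"
        using ed[OF st] C[OF st(2)] by (intro mult_mono) (use c0 in simp_all)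
      show "exp (lam * s) * \<bar>V (x t) - V (x s)\<bar> \<le> c * (L * norm (x t - x s))"
        using L(2)[OF R[OF st(2)] R[OF st(1)]] c[OF st(1)] by (intro mult_mono) (use c0 in simp_all)
    qed
    also have "\<dots> \<le> (c * \<bar>lam\<bar> * \<bar>C\<bar> + c * L + 1) * (\<bar>t - s\<bar> + norm (x t - x s))"
    proof -
      have "0 \<le> c * \<bar>lam\<bar> * \<bar>C\<bar> * norm (x t - x s)" "0 \<le> c * L * \<bar>t - s\<bar>" using L(1) c0 by simp_all
      then show ?thesis by (simp add: algebra_simps)
    qed
    finally show "norm (exp (lam * t) * V (x t) - exp (lam * s) * V (x s)) \<le> \<dots>" .
  qed
  show "AE t in lebesgue. a < t \<and> t < b \<longrightarrow> (\<exists>D\<le>0. ((\<lambda>t. exp (lam * t) * V (x t)) has_real_derivative D) (at t))"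
    using der
  proof (rule AE_mp, intro always_eventually allI impI)
    fix t assume "a < t \<and> t < b \<longrightarrow> (\<exists>w. (x has_vector_derivative w) (at t) \<and> frechet_derivative V (at (x t)) w \<le> - lam * V (x t))"
      and "a < t \<and> t < b"
    then obtain w where w: "(x has_vector_derivative w) (at t)" "frechet_derivative V (at (x t)) w \<le> - lam * V (x t)" by blast
    have "((\<lambda>t. V (x t)) has_vector_derivative frechet_derivative V (at (x t)) w) (at t)"
      using vector_derivative_diff_chain_within[of x w t UNIV V "frechet_derivative V (at (x t))"] w(1)
        has_derivative_at_withinI[OF C1_has_derivative[OF V]] by (simp add: o_def)
    then have "((\<lambda>t. V (x t)) has_real_derivative frechet_derivative V (at (x t)) w) (at t)"
      by (simp add: has_real_derivative_iff_has_vector_derivative)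
    then have "((\<lambda>t. exp (lam * t) * V (x t)) has_real_derivative
        exp (lam * t) * (lam * V (x t) + frechet_derivative V (at (x t)) w)) (at t)"
      by (auto intro!: derivative_eq_intros simp: algebra_simps)
    moreover have "exp (lam * t) * (lam * V (x t) + frechet_derivative V (at (x t)) w) \<le> 0"
      using w(2) by (simp add: mult_nonneg_nonpos)
    ultimately show "\<exists>D\<le>0. ((\<lambda>t. exp (lam * t) * V (x t)) has_real_derivative D) (at t)" by blast
  qed
qed

section \<open>Paths with finitely many switches\<close>

text \<open>The set counted by \<^const>\<open>num_switches\<close>, for a single path.\<close>

definition switch_times :: "(real \<Rightarrow> nat) \<Rightarrow> real \<Rightarrow> real set" where
  "switch_times s t = {r \<in> {0<..t}. \<not> isCont s r}"

lemma cadlag_right_constant: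
  assumes "cadlag s" "t \<ge> 0"
  obtains d where "d > 0" "\<And>u. t \<le> u \<Longrightarrow> u < t + d \<Longrightarrow> s u = s t"
proof -
  have "continuous (at_right t) s" using assms by (simp add: cadlag_def)
  then have "(s \<longlongrightarrow> s t) (at_right t)" by (simp add: continuous_within)
  then have "eventually (\<lambda>u. s u = s t) (at_right t)" by (simp add: tendsto_discrete)
  then obtain b where b: "b > t" "\<And>u. t < u \<Longrightarrow> u < b \<Longrightarrow> s u = s t"
    unfolding eventually_at_right_field by blast
  show ?thesis
  proof (rule that[of "b - t"])
    fix u assume "t \<le> u" "u < t + (b - t)"
    then show "s u = s t" using b(2)[of u] by (cases "u = t") simp_all
  qed (use b in simp)
qed

lemma cadlag_left_constant:
  assumes "cadlag s" "t > 0"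
  obtains l d where "d > 0" "d \<le> t" "\<And>u. t - d < u \<Longrightarrow> u < t \<Longrightarrow> s u = l"
proof -
  obtain l where "(s \<longlongrightarrow> l) (at_left t)" using assms unfolding cadlag_def by blast
  then have "eventually (\<lambda>u. s u = l) (at_left t)" by (simp add: tendsto_discrete)
  then obtain b where b: "b < t" "\<And>u. b < u \<Longrightarrow> u < t \<Longrightarrow> s u = l"
    unfolding eventually_at_left_field by blast
  show ?thesis
    by (rule that[of "min (t - b) t" l]) (use b assms in auto)
qed

lemma isCont_if_locally_constant:
  fixes s :: "real \<Rightarrow> nat"
  assumes "a < t" "t < b" "\<And>u. a < u \<Longrightarrow> u < b \<Longrightarrow> s u = c"
  shows "isCont s t"
proof -
  have "eventually (\<lambda>u. s u = s t) (at t)"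
    unfolding eventually_at_topological
    by (rule exI[of _ "{a<..<b}"]) (use assms in auto)
  then show ?thesis by (simp add: isCont_def tendsto_discrete)
qed

text \<open>A path with values in a discrete space is constant on either side of each time, so every
discontinuity is isolated and is recognised by comparing the left limit with the value.\<close>

lemma cadlag_two_sided:
  assumes "cadlag s" "t > 0"
  obtains l d where "d > 0" "d \<le> t" "\<And>u. t - d < u \<Longrightarrow> u < t \<Longrightarrow> s u = l"
    "\<And>u. t \<le> u \<Longrightarrow> u < t + d \<Longrightarrow> s u = s t"
    "isCont s t \<longleftrightarrow> l = s t"
    "\<And>u. t - d < u \<Longrightarrow> u < t + d \<Longrightarrow> u \<noteq> t \<Longrightarrow> isCont s u"
proof -
  obtain l d1 where l: "d1 > 0" "d1 \<le> t" "\<And>u. t - d1 < u \<Longrightarrow> u < t \<Longrightarrow> s u = l"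
    using cadlag_left_constant[OF assms] by metis
  obtain d2 where r: "d2 > 0" "\<And>u. t \<le> u \<Longrightarrow> u < t + d2 \<Longrightarrow> s u = s t"
    using cadlag_right_constant[of s t] assms by (metis less_imp_le)
  let ?d = "min d1 d2"
  show ?thesis
  proof (rule that[of ?d l])
    show "isCont s t \<longleftrightarrow> l = s t"
    proof
      assume "isCont s t"
      then have "eventually (\<lambda>u. s u = s t) (at_left t)"
        by (auto simp: isCont_def tendsto_discrete eventually_at_split)
      then obtain b where b: "b < t" "\<And>u. b < u \<Longrightarrow> u < t \<Longrightarrow> s u = s t"
        unfolding eventually_at_left_field by blast
      obtain u where "max b (t - d1) < u" "u < t" using b(1) l(1) by (meson dense diff_less_eq less_add_same_cancel1 max_less_iff_conj)
      then show "l = s t" using b(2)[of u] l(3)[of u] by simp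
    next
      assume "l = s t"
      then have "s u = l" if "t - d1 < u" "u < t + d2" for u
        using l(3)[of u] r(2)[of u] that by (cases "u < t") auto
      then show "isCont s t"
        using l(1) r(1) by (intro isCont_if_locally_constant[of "t - d1" t "t + d2" s l]) simp_all
    qed
    show "s u = l" if "t - ?d < u" "u < t" for u by (rule l(3)) (use that in auto)
    show "s u = s t" if "t \<le> u" "u < t + ?d" for u by (rule r(2)) (use that in auto)
    fix u assume u: "t - ?d < u" "u < t + ?d" "u \<noteq> t"
    then consider "t - d1 < u" "u < t" | "t < u" "u < t + d2" by linarith
    then show "isCont s u"
    proof cases
      case 1 then show ?thesis using l by (intro isCont_if_locally_constant[of "t - d1" u t s l]) auto
    next
      case 2 then show ?thesis by (rule isCont_if_locally_constant) (rule r(2), auto)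
    qed
  qed (use l(1,2) r(1) in auto)
qed

text \<open>An accumulation point of switches in the compact interval would contradict that discontinuities
are isolated.\<close>

lemma finite_switch_times:
  assumes "cadlag s"
  shows "finite (switch_times s T)"
proof (rule ccontr)
  assume inf: "infinite (switch_times s T)"
  have "switch_times s T \<subseteq> {0..T}" by (auto simp: switch_times_def)
  then obtain t where t: "t \<in> {0..T}" "t islimpt switch_times s T"
    using inf compact_Icc[of 0 T] unfolding compact_eq_Bolzano_Weierstrass by meson
  have "\<exists>d>0. \<forall>u. u \<noteq> t \<longrightarrow> dist u t < d \<longrightarrow> u \<notin> switch_times s T"
  proof (cases "t = 0")
    case True
    obtain d where "d > 0" and d: "\<And>u. t \<le> u \<Longrightarrow> u < t + d \<Longrightarrow> s u = s t"
      using cadlag_right_constant[of s t] assms True by auto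
    have "isCont s u" if "0 < u" "u < d" for u
    proof (rule isCont_if_locally_constant[OF that, of s "s t"])
      show "s v = s t" if "0 < v" "v < d" for v by (rule d) (use that True in auto)
    qed
    then show ?thesis using \<open>d > 0\<close> True by (intro exI[of _ d]) (auto simp: switch_times_def)
  next
    case False
    then have "t > 0" using t by auto
    from cadlag_two_sided[OF assms this] obtain d where "d > 0"
      "\<And>u. t - d < u \<Longrightarrow> u < t + d \<Longrightarrow> u \<noteq> t \<Longrightarrow> isCont s u" by metis
    then show ?thesis by (intro exI[of _ d]) (auto simp: switch_times_def dist_real_def abs_less_iff)
  qed
  then show False using t(2) unfolding islimpt_approachable by metis
qed

lemma card_switch_times_split:
  assumes "cadlag s" "u \<le> t"
  shows "card (switch_times s t) = card (switch_times s u) + card (switch_times s t \<inter> {u<..})"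
proof -
  have "switch_times s t = switch_times s u \<union> (switch_times s t \<inter> {u<..})"
    using assms(2) by (auto simp: switch_times_def)
  moreover have "switch_times s u \<inter> (switch_times s t \<inter> {u<..}) = {}" by (auto simp: switch_times_def)
  ultimately show ?thesis
    using finite_switch_times[OF assms(1)] by (metis card_Un_disjoint finite_Int)
qed

lemma card_switch_times_mono:
  assumes "cadlag s" "u \<le> t"
  shows "card (switch_times s u) \<le> card (switch_times s t)"
  using card_switch_times_split[OF assms] by simp

text \<open>The local-to-global principle for decreasing functions, applied to the indicator of having left
the value at \<open>a\<close>.\<close>

lemma no_switch_imp_constant:
  assumes "cadlag s" "0 \<le> a" "a \<le> b" "switch_times s b \<inter> {a<..} = {}"
  shows "s b = s a"
proof -
  define h :: "real \<Rightarrow> real" where "h t = (if s t = s a then 0 else 1)" for t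
  have "h b \<le> h a"
  proof (rule locally_decreasing_imp_le[OF assms(3)])
    fix t assume t: "t \<in> {a..b}"
    show "\<exists>d>0. \<forall>u v. a \<le> u \<longrightarrow> u \<le> t \<longrightarrow> t \<le> v \<longrightarrow> v \<le> b \<longrightarrow> t - d < u \<longrightarrow> v < t + d \<longrightarrow> h v \<le> h u"
    proof (cases "t = a")
      case True
      obtain d where "d > 0" "\<And>u. t \<le> u \<Longrightarrow> u < t + d \<Longrightarrow> s u = s t"
        using cadlag_right_constant[of s t] assms t by auto
      then show ?thesis using True unfolding h_def by (metis antisym order_refl diff_add_cancel add.commute)
    next
      case False
      then have "t > 0" "t \<notin> switch_times s b" using t assms(2,4) by auto
      then have "t > 0" "isCont s t" using t by (auto simp: switch_times_def)
      from cadlag_two_sided[OF assms(1) this(1)] obtain d l where d: "d > 0" 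
        "\<And>u. t - d < u \<Longrightarrow> u < t \<Longrightarrow> s u = l" "\<And>u. t \<le> u \<Longrightarrow> u < t + d \<Longrightarrow> s u = s t" "isCont s t \<longleftrightarrow> l = s t" by metis
      have "s u = s t" if "t - d < u" "u < t + d" for u
        using d(2-4) that \<open>isCont s t\<close> by (metis not_less)
      then have "h v = h u" if "u \<le> t" "t \<le> v" "t - d < u" "v < t + d" for u v
        using that unfolding h_def by (metis add_less_cancel_left d(1) diff_add_cancel diff_gt_0_iff_gt le_less_trans less_add_same_cancel1 less_le_trans)
      then show ?thesis using d(1) by (intro exI[of _ d]) auto
    qed
  qed
  then show ?thesis by (auto simp: h_def split: if_splits)
qed

text \<open>The multiple Lyapunov function estimate. The quantity
\<open>exp (lam * t) * V (s t) (x t) / \<mu> ^ n t\<close>, where \<open>n t\<close> is the number of switches so far, never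
increases: between switches by dissipation, and at a switch because the factor \<open>\<mu>\<close> lost in
changing the Lyapunov function is absorbed by the denominator. The vector field is an
arbitrary \<open>G\<close>, so that the estimate also serves for the truncated field in the existence
proof.\<close>

lemma switched_decay:
  fixes V :: "nat \<Rightarrow> 'a::euclidean_space \<Rightarrow> real"
  assumes s: "cadlag s" and sP: "\<And>t. t \<ge> 0 \<Longrightarrow> s t \<in> P"
    and V: "\<And>p. p \<in> P \<Longrightarrow> C_k 1 (V p)"
    and \<mu>: "\<mu> > 0" "\<And>p q y. p \<in> P \<Longrightarrow> q \<in> P \<Longrightarrow> V p y \<le> \<mu> * V q y"
    and ac: "\<And>T. T \<ge> 0 \<Longrightarrow> abs_continuous_on 0 T x"
    and der: "AE t in lebesgue. 0 < t \<longrightarrow> (x has_vector_derivative G t (x t)) (at t)"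
    and dis: "\<And>t y. t > 0 \<Longrightarrow> frechet_derivative (V (s t)) (at y) (G t y) \<le> - lam * V (s t) y"
    and T: "T \<ge> 0"
  shows "V (s T) (x T) \<le> \<mu> ^ card (switch_times s T) * exp (- lam * T) * V (s 0) (x 0)"
proof -
  define n where "n t = card (switch_times s t)" for t
  define Z where "Z t = exp (lam * t) * V (s t) (x t) / \<mu> ^ n t" for t
  have mode: "exp (lam * b) * V p (x b) \<le> exp (lam * a) * V p (x a)"
    if "p \<in> P" "0 \<le> a" "a \<le> b" and sp: "\<And>t. a < t \<Longrightarrow> t < b \<Longrightarrow> s t = p" for p a b
  proof (rule exponential_decay_along_curve[OF V[OF that(1)] that(3)])
    show "abs_continuous_on a b x"
      using ac[of b] that by (intro abs_continuous_on_subset[of 0 b x a b]) auto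
    show "AE t in lebesgue. a < t \<and> t < b \<longrightarrow>
      (\<exists>w. (x has_vector_derivative w) (at t) \<and> frechet_derivative (V p) (at (x t)) w \<le> - lam * V p (x t))"
      using der
    proof (rule AE_mp, intro always_eventually allI impI)
      fix t assume "0 < t \<longrightarrow> (x has_vector_derivative G t (x t)) (at t)" "a < t \<and> t < b"
      moreover have "0 < t" using calculation(2) that by linarith
      ultimately show "\<exists>w. (x has_vector_derivative w) (at t) \<and> frechet_derivative (V p) (at (x t)) w \<le> - lam * V p (x t)"
        using dis[of t "x t"] sp[of t] by auto
    qed
  qed
  have right: "\<exists>d>0. \<forall>v. t \<le> v \<longrightarrow> v < t + d \<longrightarrow> Z v \<le> Z t" if t: "t \<ge> 0" for t
  proof -
    obtain d where d: "d > 0" "\<And>u. t \<le> u \<Longrightarrow> u < t + d \<Longrightarrow> s u = s t"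
      using cadlag_right_constant[OF s t] by blast
    have "Z v \<le> Z t" if v: "t \<le> v" "v < t + d" for v
    proof -
      have "isCont s r" if "r \<in> {t<..v}" for r
      proof (rule isCont_if_locally_constant[of t r "t + d" s "s t"])
        show "s w = s t" if "t < w" "w < t + d" for w by (rule d(2)) (use that in auto)
      qed (use that v in auto)
      then have "switch_times s v \<inter> {t<..} = {}" by (auto simp: switch_times_def)
      then have "n v = n t" using card_switch_times_split[OF s v(1)] by (simp add: n_def)
      moreover have "exp (lam * v) * V (s t) (x v) \<le> exp (lam * t) * V (s t) (x t)"
        by (rule mode[OF sP[OF t] t v(1)]) (rule d(2), use v in auto)
      moreover have "s v = s t" using d v by blast
      ultimately show ?thesis using \<mu>(1) by (simp add: Z_def divide_right_mono)
    qed
    then show ?thesis using d(1) by blast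
  qed
  have left: "\<exists>d>0. \<forall>u. 0 \<le> u \<longrightarrow> u \<le> t \<longrightarrow> t - d < u \<longrightarrow> Z t \<le> Z u" if t: "t > 0" for t
  proof -
    obtain l d where d: "d > 0" "d \<le> t" "\<And>u. t - d < u \<Longrightarrow> u < t \<Longrightarrow> s u = l"
      and c: "isCont s t \<longleftrightarrow> l = s t" "\<And>u. t - d < u \<Longrightarrow> u < t + d \<Longrightarrow> u \<noteq> t \<Longrightarrow> isCont s u"
      using cadlag_two_sided[OF s t] by metis
    have "Z t \<le> Z u" if u: "0 \<le> u" "u \<le> t" "t - d < u" for u
    proof (cases "u = t")
      case False
      then have "u < t" using u by simp
      have su: "s u = l" using d(3) u \<open>u < t\<close> by blast
      then have "l \<in> P" using sP u by blast
      have sw: "switch_times s t \<inter> {u<..} = (if l = s t then {} else {t})"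
      proof -
        have "isCont s r" if "u < r" "r < t" for r
          by (rule c(2)) (use that u d(1) in auto)
        then have "switch_times s t \<inter> {u<..} = {r \<in> {t}. \<not> isCont s r}"
          using t \<open>u < t\<close> unfolding switch_times_def by (auto simp: le_less)
        then show ?thesis using c(1) by auto
      qed
      have 1: "exp (lam * t) * V l (x t) \<le> exp (lam * u) * V l (x u)"
        using u d \<open>l \<in> P\<close> by (intro mode) auto
      show ?thesis
      proof (cases "l = s t")
        case True
        then have "n t = n u" using card_switch_times_split[OF s u(2)] sw by (simp add: n_def)
        then show ?thesis using 1 True su \<mu>(1) by (simp add: Z_def divide_right_mono)
      next
        case False
        then have "n t = Suc (n u)" using card_switch_times_split[OF s u(2)] sw by (simp add: n_def)
        moreover have "exp (lam * t) * V (s t) (x t) \<le> \<mu> * (exp (lam * u) * V l (x u))"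
        proof -
          have "exp (lam * t) * V (s t) (x t) \<le> exp (lam * t) * (\<mu> * V l (x t))"
            using \<mu>(2) sP[of t] t \<open>l \<in> P\<close> by (intro mult_left_mono) auto
          also have "\<dots> = \<mu> * (exp (lam * t) * V l (x t))" by simp
          also have "\<dots> \<le> \<mu> * (exp (lam * u) * V l (x u))" using 1 \<mu>(1) by (intro mult_left_mono) auto
          finally show ?thesis .
        qed
        ultimately show ?thesis using \<mu>(1) su by (simp add: Z_def field_simps)
      qed
    qed simp
    then show ?thesis using d(1) by blast
  qed
  have "Z T \<le> Z 0"
  proof (rule locally_decreasing_imp_le[OF T])
    fix t assume t: "t \<in> {0..T}"
    then obtain d1 where d1: "d1 > 0" "\<And>v. t \<le> v \<Longrightarrow> v < t + d1 \<Longrightarrow> Z v \<le> Z t" using right[of t] by auto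
    obtain d2 where d2: "d2 > 0" "\<And>u. 0 \<le> u \<Longrightarrow> u \<le> t \<Longrightarrow> t - d2 < u \<Longrightarrow> Z t \<le> Z u"
    proof (cases "t = 0")
      case True then show ?thesis using that[of 1] by auto
    next
      case False then show ?thesis using left[of t] t that by auto
    qed
    show "\<exists>d>0. \<forall>u v. 0 \<le> u \<longrightarrow> u \<le> t \<longrightarrow> t \<le> v \<longrightarrow> v \<le> T \<longrightarrow> t - d < u \<longrightarrow> v < t + d \<longrightarrow> Z v \<le> Z u"
    proof (intro exI[of _ "min d1 d2"] conjI allI impI)
      fix u v assume "0 \<le> u" "u \<le> t" "t \<le> v" "t - min d1 d2 < u" "v < t + min d1 d2"
      then have "Z v \<le> Z t" "Z t \<le> Z u" by (auto intro!: d1(2) d2(2))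
      then show "Z v \<le> Z u" by simp
    qed (use d1 d2 in simp)
  qed
  moreover have "n 0 = 0" by (simp add: n_def switch_times_def)
  ultimately have "exp (lam * T) * V (s T) (x T) \<le> \<mu> ^ n T * V (s 0) (x 0)"
    using \<mu>(1) by (simp add: Z_def field_simps)
  then have A: "exp (- lam * T) * (exp (lam * T) * V (s T) (x T)) \<le> exp (- lam * T) * (\<mu> ^ n T * V (s 0) (x 0))"
    by (rule mult_left_mono) simp
  have "exp (- lam * T) * exp (lam * T) = 1" by (simp flip: exp_add)
  then have "V (s T) (x T) = exp (- lam * T) * (exp (lam * T) * V (s T) (x T))"
    by (simp only: mult.assoc[symmetric] mult_1)
  also note A
  also have "exp (- lam * T) * (\<mu> ^ n T * V (s 0) (x 0)) = \<mu> ^ n T * exp (- lam * T) * V (s 0) (x 0)"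
    by (simp only: ac_simps)
  finally show ?thesis unfolding n_def .
qed

section \<open>Caratheodory existence\<close>

lemma lipschitz_below_imp_continuous:
  fixes z :: "real \<Rightarrow> 'a::real_normed_vector"
  assumes "\<And>T s t. s \<le> T \<Longrightarrow> t \<le> T \<Longrightarrow> norm (z t - z s) \<le> B T * \<bar>t - s\<bar>"
  shows "continuous_on UNIV z"
proof (rule continuous_at_imp_continuous_on, rule ballI)
  fix t :: real
  have b: "\<bar>B (t + 1)\<bar> + 1 > 0" by linarith
  show "isCont z t"
    unfolding isCont_def LIM_eq
  proof (intro allI impI)
    fix e :: real assume e: "e > 0"
    show "\<exists>d>0. \<forall>s. s \<noteq> t \<and> norm (s - t) < d \<longrightarrow> norm (z s - z t) < e"
    proof (intro exI[of _ "min 1 (e / (\<bar>B (t + 1)\<bar> + 1))"] conjI allI impI)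
      show "0 < min 1 (e / (\<bar>B (t + 1)\<bar> + 1))" using e b by simp
      fix s assume "s \<noteq> t \<and> norm (s - t) < min 1 (e / (\<bar>B (t + 1)\<bar> + 1))"
      then have s: "norm (s - t) < min 1 (e / (\<bar>B (t + 1)\<bar> + 1))" by blast
      then have "s \<le> t + 1" by (simp add: abs_less_iff)
      then have "norm (z s - z t) \<le> B (t + 1) * \<bar>s - t\<bar>" using assms[of t "t + 1" s] by simp
      also have "\<dots> \<le> (\<bar>B (t + 1)\<bar> + 1) * \<bar>s - t\<bar>" by (intro mult_right_mono) auto
      also have "\<dots> < e" using s b by (simp add: pos_less_divide_eq mult.commute)
      finally show "norm (z s - z t) < e" .
    qed
  qed
qed

text \<open>The field is only continuous in the state, so Picard iteration is not available and existence is
obtained from compactness. Tonelli's delayed equations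
\<open>x t = x0 + integral {0..t} (\<lambda>s. G s (x (s - h)))\<close> are solved step by step without any fixed
point argument; their solutions share local Lipschitz constants, so a subsequence converges at all
rationals and hence everywhere, and dominated convergence passes to the limit \<open>h \<rightarrow> 0\<close>.
The field is continuous outside countably many times, which gives measurability of
\<open>s \<mapsto> G s (z s)\<close> and the derivative of the integral at the remaining times.\<close>

proposition caratheodory_existence:
  fixes G :: "real \<Rightarrow> 'a::euclidean_space \<Rightarrow> 'a"
  assumes X: "countable X"
    and cont_y: "\<And>t. continuous_on UNIV (G t)"
    and cont: "\<And>t y. t \<notin> X \<Longrightarrow> isCont (\<lambda>(t, y). G t y) (t, y)"
    and bnd: "\<And>T. \<exists>b. \<forall>t y. t \<le> T \<longrightarrow> norm (G t y) \<le> b"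
  obtains x where "x 0 = x0" "\<And>T. abs_continuous_on 0 T x"
    "\<And>t. t > 0 \<Longrightarrow> t \<notin> X \<Longrightarrow> (x has_vector_derivative G t (x t)) (at t)"
proof -
  obtain B where B: "\<And>T t y. t \<le> T \<Longrightarrow> norm (G t y) \<le> B T" using bnd by metis
  have B0: "B T \<ge> 0" for T using B[of T T 0] norm_ge_zero order_trans by blast
  have isC: "isCont (\<lambda>s. G s (z s)) t" if "continuous_on UNIV z" "t \<notin> X" for z t
  proof -
    have "isCont z t" using that(1) by (simp add: continuous_on_eq_continuous_at)
    then have "isCont (\<lambda>s. (s, z s)) t" by (intro continuous_intros)
    then show ?thesis using isCont_o2[of t "\<lambda>s. (s, z s)" "\<lambda>(t, y). G t y"] cont[OF that(2)] by simp
  qed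
  have integ: "(\<lambda>s. G s (z s)) integrable_on {a..t}" if z: "continuous_on UNIV z" for z a t
  proof (rule measurable_bounded_by_integrable_imp_integrable[where g = "\<lambda>_. B t"])
    have "continuous_on (- X) (\<lambda>s. G s (z s))"
      using isC[OF z] by (intro continuous_at_imp_continuous_on) simp
    then have "(\<lambda>s. G s (z s)) \<in> borel_measurable borel"
      by (rule borel_measurable_continuous_countable_exceptions[OF X])
    then show "(\<lambda>s. G s (z s)) \<in> borel_measurable (lebesgue_on {a..t})"
      by (intro measurable_restrict_space1 measurable_completion) simp
    show "norm (G s (z s)) \<le> B t" if "s \<in> {a..t}" for s using B that by simp
  qed (simp_all add: integrable_const_ivl)
  define I where "I z t = x0 + integral {0..t} (\<lambda>s. G s (z s))" for z t
  have I0: "I z t = x0" if "t \<le> 0" for z t using that by (cases "t = 0") (simp_all add: I_def)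
  have lip0: "norm (I z t - I z s) \<le> B T * (t - s)" if z: "continuous_on UNIV z" and st: "0 \<le> s" "s \<le> t" "t \<le> T" for z s t T
  proof -
    have "I z t - I z s = integral {s..t} (\<lambda>s. G s (z s))"
      using Henstock_Kurzweil_Integration.integral_combine[OF st(1,2) integ[OF z]] by (simp add: I_def algebra_simps)
    also have "norm \<dots> \<le> B T * (t - s)"
    proof -
      have "norm (integral {s..t} (\<lambda>s. G s (z s))) \<le> integral {s..t} (\<lambda>_. B T)"
        by (rule integral_norm_bound_integral[OF integ[OF z] integrable_const_ivl]) (use B st in simp)
      then show ?thesis using st by (simp add: mult.commute)
    qed
    finally show ?thesis .
  qed
  have lip: "norm (I z t - I z s) \<le> B T * \<bar>t - s\<bar>" if z: "continuous_on UNIV z" and st: "s \<le> T" "t \<le> T" for z s t T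
  proof -
    have *: "norm (I z t - I z s) \<le> B T * (t - s)" if "s \<le> t" "t \<le> T" for s t
    proof -
      consider "t \<le> 0" | "s \<le> 0" "0 \<le> t" | "0 \<le> s" by linarith
      then show ?thesis
      proof cases
        case 1 then show ?thesis using that B0 by (simp add: I0)
      next
        case 2
        then have "norm (I z t - I z s) \<le> B T * (t - 0)" using lip0[OF z, of 0 t T] that by (simp add: I0)
        also have "\<dots> \<le> B T * (t - s)" using 2 B0 by (intro mult_left_mono) simp_all
        finally show ?thesis .
      next
        case 3 then show ?thesis using lip0[OF z] that by simp
      qed
    qed
    show ?thesis using *[of s t] *[of t s] st by (cases "s \<le> t") (simp_all add: norm_minus_commute)
  qed
  have contI: "continuous_on UNIV (I z)" if "continuous_on UNIV z" for z
    using lipschitz_below_imp_continuous lip[OF that] by blast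
  \<comment> \<open>Iterating the delayed integral operator \<open>k\<close> times solves the delayed equation up to time
  \<open>k * h\<close>: the values up to there no longer change.\<close>
  define y where "y h k = ((\<lambda>z. I (\<lambda>s. z (s - h))) ^^ k) (\<lambda>_. x0)" for h :: real and k
  have ySuc: "y h (Suc k) = I (\<lambda>s. y h k (s - h))" for h k by (simp add: y_def)
  have shift: "continuous_on UNIV (\<lambda>s. z (s - h))" if "continuous_on UNIV z" for z :: "real \<Rightarrow> 'a" and h
    by (rule continuous_on_compose2[OF that]) (auto intro!: continuous_intros)
  have ycont: "continuous_on UNIV (y h k)" for h k
    by (induction k) (simp_all add: y_def contI shift)
  have stab: "y h (Suc k) t = y h k t" if "t \<le> real k * h" for h k t
    using that
  proof (induction k arbitrary: t)
    case 0 then show ?case unfolding ySuc by (simp add: I0) (simp add: y_def)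
  next
    case (Suc k)
    have "integral {0..t} (\<lambda>s. G s (y h (Suc k) (s - h))) = integral {0..t} (\<lambda>s. G s (y h k (s - h)))"
    proof (rule Henstock_Kurzweil_Integration.integral_cong)
      fix s assume "s \<in> {0..t}"
      then have "s - h \<le> real k * h" using Suc.prems by (simp add: algebra_simps)
      then show "G s (y h (Suc k) (s - h)) = G s (y h k (s - h))" using Suc.IH by simp
    qed
    then show ?case unfolding ySuc[of h "Suc k"] ySuc[of h k] I_def by simp
  qed
  define h where "h n = 1 / real (Suc n)" for n
  \<comment> \<open>With delay \<open>1 / (n + 1)\<close>, this many iterations reach time \<open>n + 1\<close>.\<close>
  define K where "K n = Suc n * Suc n" for n
  define z where "z n s = y (h n) (K n) (s - h n)" for n s
  define xx where "xx n = I (z n)" for n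
  have zc: "continuous_on UNIV (z n)" for n unfolding z_def by (intro shift ycont)
  have z_eq: "z n s = xx n (s - h n)" if "s \<le> real n" for n s
  proof -
    have "real (K n) * h n = real (Suc n)" unfolding K_def h_def of_nat_mult by (simp del: of_nat_Suc)
    moreover have "h n \<ge> 0" by (simp add: h_def)
    ultimately have "s - h n \<le> real (K n) * h n" using that by linarith
    then have "y (h n) (Suc (K n)) (s - h n) = y (h n) (K n) (s - h n)" by (rule stab)
    moreover have "xx n = y (h n) (Suc (K n))" by (simp only: xx_def ySuc z_def[abs_def])
    ultimately show ?thesis by (simp add: z_def)
  qed
  have xl: "norm (xx n t - xx n s) \<le> B T * \<bar>t - s\<bar>" if "s \<le> T" "t \<le> T" for n s t T
    unfolding xx_def using lip[OF zc that] .
  \<comment> \<open>Bounds on \<open>xx n q\<close> grow with \<open>q\<close>; rescaling by them makes the diagonal argument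
  for uniformly bounded sequences applicable.\<close>
  define c where "c q = norm x0 + B \<bar>q\<bar> * \<bar>q\<bar> + 1" for q
  have c0: "c q > 0" for q unfolding c_def using B0 by (intro add_nonneg_pos add_nonneg_nonneg mult_nonneg_nonneg) simp_all
  have xc: "norm (xx n q) \<le> c q" for n q
  proof -
    have "norm (xx n q - xx n 0) \<le> B \<bar>q\<bar> * \<bar>q - 0\<bar>" by (rule xl) simp_all
    moreover have "xx n 0 = x0" by (simp add: xx_def I0)
    ultimately show ?thesis using norm_triangle_ineq2[of "xx n q" x0] by (simp add: c_def)
  qed
  obtain k where k: "strict_mono (k::nat\<Rightarrow>nat)"
    and kl: "\<And>q. q \<in> \<rat> \<Longrightarrow> \<exists>l. (\<lambda>n. (1 / c q) *\<^sub>R xx (k n) q) \<longlonglongrightarrow> l"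
  proof (rule function_convergent_subsequence[of \<rat> "\<lambda>n q. (1 / c q) *\<^sub>R xx n q" 1])
    show "norm ((1 / c q) *\<^sub>R xx n q) \<le> 1" for n q using xc[of n q] c0[of q] by simp
  qed (use countable_rat in blast)+
  have convq: "Cauchy (\<lambda>n. xx (k n) q)" if q: "q \<in> \<rat>" for q
  proof -
    obtain l where "(\<lambda>n. (1 / c q) *\<^sub>R xx (k n) q) \<longlonglongrightarrow> l" using kl q by blast
    then have "(\<lambda>n. c q *\<^sub>R ((1 / c q) *\<^sub>R xx (k n) q)) \<longlonglongrightarrow> c q *\<^sub>R l" by (intro tendsto_intros)
    then have "(\<lambda>n. xx (k n) q) \<longlonglongrightarrow> c q *\<^sub>R l" using c0[of q] by simp
    then show ?thesis by (rule LIMSEQ_imp_Cauchy)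
  qed
  have cau: "Cauchy (\<lambda>n. xx (k n) t)" for t
  proof (rule metric_CauchyI)
    fix e :: real assume e: "e > 0"
    define b where "b = B (t + 1) + 1"
    have b: "b > 0" using B0[of "t + 1"] by (simp add: b_def)
    have "t < t + min 1 (e / (4 * b))" using e b by simp
    then obtain q where q: "q \<in> \<rat>" "t < q" "q < t + min 1 (e / (4 * b))" using Rats_dense_in_real by blast
    have near: "dist (xx n t) (xx n q) \<le> e / 4" for n
    proof -
      have "dist (xx n t) (xx n q) \<le> B (t + 1) * \<bar>t - q\<bar>"
        unfolding dist_norm using q by (intro xl) simp_all
      also have "\<dots> \<le> b * (e / (4 * b))" using q b e B0 by (intro mult_mono) (simp_all add: b_def)
      also have "\<dots> = e / 4" using b by simp
      finally show ?thesis .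
    qed
    obtain M where M: "\<And>m n. m \<ge> M \<Longrightarrow> n \<ge> M \<Longrightarrow> dist (xx (k m) q) (xx (k n) q) < e / 4"
      using metric_CauchyD[OF convq[OF q(1)], of "e / 4"] e by auto
    show "\<exists>M. \<forall>m\<ge>M. \<forall>n\<ge>M. dist (xx (k m) t) (xx (k n) t) < e"
    proof (intro exI[of _ M] allI impI)
      fix m n assume mn: "m \<ge> M" "n \<ge> M"
      have "dist (xx (k m) t) (xx (k n) t) \<le> dist (xx (k m) t) (xx (k m) q) + dist (xx (k m) q) (xx (k n) q) + dist (xx (k n) t) (xx (k n) q)"
        by (metis (no_types) add_right_mono dist_commute dist_triangle dist_triangle_le order_refl)
      also have "\<dots> < e" using near[of "k m"] near[of "k n"] M[OF mn] e by linarith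
      finally show "dist (xx (k m) t) (xx (k n) t) < e" .
    qed
  qed
  have "\<exists>l. (\<lambda>n. xx (k n) t) \<longlonglongrightarrow> l" for t
    using Cauchy_convergent[OF cau[of t]] unfolding convergent_def .
  then obtain x where x: "\<And>t. (\<lambda>n. xx (k n) t) \<longlonglongrightarrow> x t" by metis
  have xlip: "norm (x t - x s) \<le> B T * \<bar>t - s\<bar>" if "s \<le> T" "t \<le> T" for s t T
    by (rule LIMSEQ_le_const2[OF tendsto_norm[OF tendsto_diff[OF x x]]]) (use xl[OF that] in blast)
  have xcont: "continuous_on UNIV x" using lipschitz_below_imp_continuous xlip by blast
  have zlim: "(\<lambda>n. z (k n) s) \<longlonglongrightarrow> x s" for s
  proof -
    have "(\<lambda>n. xx (k n) s - z (k n) s) \<longlonglongrightarrow> 0"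
    proof (rule Lim_null_comparison)
      have "eventually (\<lambda>n. s \<le> real n) sequentially" by real_asymp
      then have "eventually (\<lambda>n. s \<le> real (k n)) sequentially"
        by eventually_elim (metis k of_nat_mono order_trans seq_suble)
      then show "eventually (\<lambda>n. norm (xx (k n) s - z (k n) s) \<le> B s * (1 / real (Suc (k n)))) sequentially"
      proof eventually_elim
        case (elim n)
        have "norm (xx (k n) s - xx (k n) (s - h (k n))) \<le> B s * \<bar>s - (s - h (k n))\<bar>"
          by (rule xl) (simp_all add: h_def)
        then show ?case using z_eq[OF elim] by (simp add: h_def)
      qed
      have "(\<lambda>n. 1 / real (Suc (k n))) \<longlonglongrightarrow> 0"
        using LIMSEQ_subseq_LIMSEQ[OF lim_inverse_n' k] LIMSEQ_subseq_LIMSEQ[OF LIMSEQ_Suc[OF lim_1_over_n] k] by (simp add: o_def)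
      then show "(\<lambda>n. B s * (1 / real (Suc (k n)))) \<longlonglongrightarrow> 0" using tendsto_mult_right_zero by blast
    qed
    from tendsto_diff[OF x[of s] this] show ?thesis by simp
  qed
  have xI: "x t = I x t" for t
  proof -
    have "(\<lambda>n. integral {0..t} (\<lambda>s. G s (z (k n) s))) \<longlonglongrightarrow> integral {0..t} (\<lambda>s. G s (x s))"
    proof (rule dominated_convergence[where h = "\<lambda>_. B t"])
      show "(\<lambda>s. G s (z (k n) s)) integrable_on {0..t}" for n by (rule integ[OF zc])
      show "norm (G s (z (k n) s)) \<le> B t" if "s \<in> {0..t}" for n s using B that by simp
      show "(\<lambda>n. G s (z (k n) s)) \<longlonglongrightarrow> G s (x s)" for s
        by (rule continuous_on_tendsto_compose[OF cont_y zlim]) simp_all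
    qed (rule integrable_const_ivl)
    then have "(\<lambda>n. xx (k n) t) \<longlonglongrightarrow> I x t"
      unfolding xx_def I_def by (rule tendsto_add[OF tendsto_const])
    then show ?thesis using x LIMSEQ_unique by blast
  qed
  show ?thesis
  proof (rule that[of x])
    show "x 0 = x0" using xI[of 0] I0[of 0 x] by simp
    show "abs_continuous_on 0 T x" for T
      by (rule lipschitz_imp_abs_continuous_on[of 0 T x "B T"]) (use xlip in simp)
    fix t assume t: "t > 0" "t \<notin> X"
    have "((\<lambda>u. integral {0..u} (\<lambda>s. G s (x s))) has_vector_derivative G t (x t)) (at t within ({0..t + 1} - {}))"
      using t continuous_at_imp_continuous_at_within[OF isC[OF xcont t(2)]]
      by (intro integral_has_vector_derivative_continuous_at integ[OF xcont]) simp_all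
    moreover have "at t within ({0..t + 1} - {}) = at t"
      using t by (intro at_within_interior) (simp add: interior_atLeastAtMost_real)
    ultimately have "((\<lambda>u. x0 + integral {0..u} (\<lambda>s. G s (x s))) has_vector_derivative G t (x t)) (at t)"
      by (auto intro!: derivative_eq_intros)
    moreover have "(\<lambda>u. x0 + integral {0..u} (\<lambda>s. G s (x s))) = x"
      by (rule ext) (rule xI[unfolded I_def, symmetric])
    ultimately show "(x has_vector_derivative G t (x t)) (at t)" by (simp only:)
  qed
qed

section \<open>Global solutions of switched systems\<close>

text \<open>The field need not be bounded, so it is first truncated: it is multiplied by a factor that equals
\<open>1\<close> where \<open>V (s t) y \<le> m t\<close> and vanishes where \<open>V (s t) y \<ge> m t + 1\<close>, with
\<open>m t\<close> the bound that the Lyapunov estimate predicts. Truncation preserves dissipation, so the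
estimate holds for the truncated solution, which therefore never meets the truncation and solves
the original equation for all times, through all switches at once.\<close>

proposition switched_solution_exists:
  fixes V :: "nat \<Rightarrow> 'a::euclidean_space \<Rightarrow> real" and F :: "nat \<Rightarrow> 'a \<Rightarrow> 'a"
  assumes s: "cadlag s" and sP: "\<And>t. t \<ge> 0 \<Longrightarrow> s t \<in> P" and P: "finite P"
    and V: "\<And>p. p \<in> P \<Longrightarrow> C_k 1 (V p)" and V0: "\<And>p y. p \<in> P \<Longrightarrow> V p y \<ge> 0"
    and \<mu>: "\<mu> \<ge> 1" "\<And>p q y. p \<in> P \<Longrightarrow> q \<in> P \<Longrightarrow> V p y \<le> \<mu> * V q y"
    and sublevel: "\<And>p K. p \<in> P \<Longrightarrow> bounded {y. V p y \<le> K}"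
    and F: "\<And>p. p \<in> P \<Longrightarrow> continuous_on UNIV (F p)"
    and dis: "\<And>p y. p \<in> P \<Longrightarrow> frechet_derivative (V p) (at y) (F p y) \<le> 0"
  shows "\<exists>x. caratheodory_solution (\<lambda>t. F (s t)) x0 x"
proof -
  define n where "n t = card (switch_times s t)" for t
  define m where "m t = \<mu> ^ n t * V (s 0) x0" for t
  \<comment> \<open>The truncation factor.\<close>
  define c where "c t p y = max 0 (min 1 (m t + 1 - V p y))" for t p y
  define G where "G t y = (if t > 0 then c t (s t) y *\<^sub>R F (s t) y else 0)" for t y
  \<comment> \<open>The time \<open>0\<close> is exceptional because \<open>G\<close> is cut off at nonpositive times.\<close>
  define X where "X = insert 0 (\<Union>k. switch_times s (real k))"
  have Xc: "countable X" unfolding X_def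
    by (rule countable_insert, rule countable_UN) (simp_all add: countable_finite finite_switch_times[OF s])
  have contV: "continuous_on UNIV (V p)" if "p \<in> P" for p
    using C1_has_derivative[OF V[OF that]] by (meson continuous_at_imp_continuous_on has_derivative_continuous)
  have contcF: "continuous_on UNIV (\<lambda>y. c t p y *\<^sub>R F p y)" if "p \<in> P" for t p
    unfolding c_def by (intro continuous_intros F that contV[OF that])
  have m_mono: "m u \<le> m t" if "u \<le> t" for u t
    unfolding m_def n_def using \<mu>(1) V0[OF sP[of 0]] card_switch_times_mono[OF s that]
    by (intro mult_right_mono power_increasing) simp_all
  have notX: "isCont s t" if "t \<notin> X" "t > 0" for t
  proof (rule ccontr)
    assume "\<not> isCont s t"
    then have "t \<in> switch_times s (real (nat \<lceil>t\<rceil>))"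
      using that(2) of_nat_ceiling[of t] by (simp add: switch_times_def)
    then show False using that(1) unfolding X_def by blast
  qed
  have cont: "isCont (\<lambda>(t, y). G t y) (t, y)" if tX: "t \<notin> X" for t y
  proof (cases "t < 0")
    case True
    have "eventually (\<lambda>z. (case z of (t, y) \<Rightarrow> G t y) = 0) (nhds (t, y))"
      unfolding eventually_nhds
      by (rule exI[of _ "{..<0} \<times> UNIV"]) (use True in \<open>auto simp: G_def open_Times\<close>)
    then show ?thesis by (subst isCont_cong) auto
  next
    case False
    then have t: "t > 0" using tX unfolding X_def by (cases "t = 0") auto
    from cadlag_two_sided[OF s t] obtain d l where d: "d > 0" "d \<le> t"
      and l: "\<And>u. t - d < u \<Longrightarrow> u < t \<Longrightarrow> s u = l"
      and r: "\<And>u. t \<le> u \<Longrightarrow> u < t + d \<Longrightarrow> s u = s t" and c1: "isCont s t \<longleftrightarrow> l = s t"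
      and c2: "\<And>u. t - d < u \<Longrightarrow> u < t + d \<Longrightarrow> u \<noteq> t \<Longrightarrow> isCont s u" by metis
    have st: "s u = s t" if "t - d < u" "u < t + d" for u
      using l r c1 notX[OF tX t] that by (metis not_less)
    have isC: "isCont s u" if "t - d < u" "u < t + d" for u
      using c2[OF that] notX[OF tX t] by (cases "u = t") simp_all
    have nn: "n u = n v" if "t - d < u" "u \<le> v" "v < t + d" for u v
    proof -
      have "isCont s w" if "u < w" "w \<le> v" for w
        by (rule isC) (use that \<open>t - d < u\<close> \<open>v < t + d\<close> in auto)
      then have "switch_times s v \<inter> {u<..} = {}" by (auto simp: switch_times_def)
      then show ?thesis using card_switch_times_split[OF s that(2)] by (simp add: n_def)
    qed
    have nt: "n u = n t" if "t - d < u" "u < t + d" for u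
    proof (cases "u \<le> t")
      case True then show ?thesis using that d(1) by (intro nn) simp_all
    next
      case False then show ?thesis using that d(1) by (intro nn[symmetric]) simp_all
    qed
    have "eventually (\<lambda>z. (case z of (u, y) \<Rightarrow> G u y) = c t (s t) (snd z) *\<^sub>R F (s t) (snd z)) (nhds (t, y))"
      unfolding eventually_nhds
    proof (rule exI[of _ "{t - d<..<t + d} \<times> UNIV"], intro conjI ballI)
      show "open ({t - d<..<t + d} \<times> (UNIV :: 'a set))" by (intro open_Times) auto
      fix z assume "z \<in> {t - d<..<t + d} \<times> (UNIV :: 'a set)"
      then obtain u y where z: "z = (u, y)" "t - d < u" "u < t + d" by (cases z) auto
      then have "u > 0" using d by linarith
      then show "(case z of (u, y) \<Rightarrow> G u y) = c t (s t) (snd z) *\<^sub>R F (s t) (snd z)"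
        using st[OF z(2,3)] nt[OF z(2,3)] by (simp add: z(1) G_def c_def m_def)
    qed (use d in simp)
    moreover have "isCont (\<lambda>z. c t (s t) (snd z) *\<^sub>R F (s t) (snd z)) (t, y)"
    proof -
      have "isCont (\<lambda>y. c t (s t) y *\<^sub>R F (s t) y) (snd (t, y))"
        using contcF[OF sP] t by (simp add: continuous_on_eq_continuous_at)
      from isCont_o2[where f = snd and a = "(t, y)", OF _ this] show ?thesis by simp
    qed
    ultimately show ?thesis by (subst isCont_cong)
  qed
  have bnd: "\<exists>b. \<forall>t y. t \<le> T \<longrightarrow> norm (G t y) \<le> b" for T
  proof -
    define K where "K = m T + 1"
    have "bounded (\<Union>p\<in>P. {y. V p y \<le> K})" using P sublevel by (intro bounded_UN) auto
    then obtain R where R: "\<And>p y. p \<in> P \<Longrightarrow> V p y \<le> K \<Longrightarrow> norm y \<le> R"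
      unfolding bounded_iff by blast
    have "\<exists>b. \<forall>y\<in>cball 0 R. norm (F p y) \<le> b" if "p \<in> P" for p
    proof -
      have "bounded (F p ` cball 0 R)"
        by (intro compact_imp_bounded compact_continuous_image compact_cball continuous_on_subset[OF F[OF that]]) simp
      then show ?thesis unfolding bounded_iff by blast
    qed
    then obtain b where b: "\<And>p y. p \<in> P \<Longrightarrow> norm y \<le> R \<Longrightarrow> norm (F p y) \<le> b p"
      by (metis mem_cball_0)
    have S0: "0 \<le> (\<Sum>p\<in>P. \<bar>b p\<bar>)" by (simp add: sum_nonneg)
    have "norm (G t y) \<le> (\<Sum>p\<in>P. \<bar>b p\<bar>)" if "t \<le> T" for t y
    proof (cases "t > 0 \<and> V (s t) y \<le> m t + 1")
      case True
      then have p: "s t \<in> P" using sP by simp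
      have "V (s t) y \<le> K" using True m_mono[OF that] by (simp add: K_def)
      then have "norm (F (s t) y) \<le> b (s t)" using b R p by blast
      also have "\<dots> \<le> \<bar>b (s t)\<bar>" by simp
      also have "\<dots> \<le> (\<Sum>p\<in>P. \<bar>b p\<bar>)" by (rule member_le_sum[OF p]) (simp_all add: P)
      finally have 1: "norm (F (s t) y) \<le> (\<Sum>p\<in>P. \<bar>b p\<bar>)" .
      have "norm (G t y) = c t (s t) y * norm (F (s t) y)" using True by (simp add: G_def c_def)
      also have "\<dots> \<le> 1 * norm (F (s t) y)" by (intro mult_right_mono) (simp_all add: c_def)
      finally show ?thesis using 1 by simp
    next
      case False
      then have "G t y = 0" by (auto simp: G_def c_def)
      then show ?thesis using S0 by simp
    qed
    then show ?thesis by blast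
  qed
  have cont_y: "continuous_on UNIV (G t)" for t
    using contcF[OF sP, of t t] by (cases "t > 0") (simp_all add: G_def[abs_def])
  obtain x where x: "x 0 = x0" "\<And>T. abs_continuous_on 0 T x"
    "\<And>t. t > 0 \<Longrightarrow> t \<notin> X \<Longrightarrow> (x has_vector_derivative G t (x t)) (at t)"
    using caratheodory_existence[OF Xc cont_y cont bnd] by metis
  have X0: "X \<in> null_sets lebesgue"
    using countable_imp_null_set_lborel[OF Xc] by (rule null_sets_completionI)
  have dG: "AE t in lebesgue. 0 < t \<longrightarrow> (x has_vector_derivative G t (x t)) (at t)"
    by (rule AE_I'[OF X0]) (use x(3) in blast)
  have le: "V (s t) (x t) \<le> m t" if "t \<ge> 0" for t
  proof -
    have "V (s t) (x t) \<le> \<mu> ^ card (switch_times s t) * exp (- 0 * t) * V (s 0) (x 0)"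
    proof (rule switched_decay[where V = V and s = s and P = P and \<mu> = \<mu> and x = x and G = G and lam = 0, OF s sP V _ \<mu>(2) x(2) dG _ that])
      fix t :: real and y assume t: "t > 0"
      have "linear (frechet_derivative (V (s t)) (at y))"
        using C1_has_derivative[OF V[OF sP]] t has_derivative_linear less_imp_le by metis
      then have "frechet_derivative (V (s t)) (at y) (G t y) = c t (s t) y * frechet_derivative (V (s t)) (at y) (F (s t) y)"
        using t by (simp add: G_def linear_scale)
      also have "\<dots> \<le> 0" using dis[OF sP, of t y] t by (intro mult_nonneg_nonpos) (simp_all add: c_def)
      finally show "frechet_derivative (V (s t)) (at y) (G t y) \<le> - 0 * V (s t) y" by simp
    qed (use \<mu>(1) in auto)
    then show ?thesis by (simp add: m_def n_def x(1))
  qed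
  have Gx: "G t (x t) = F (s t) (x t)" if "t > 0" for t
    using le[of t] that by (simp add: G_def c_def)
  have "AE t in lebesgue. 0 < t \<longrightarrow> (x has_vector_derivative F (s t) (x t)) (at t)"
    by (rule AE_mp[OF dG], intro always_eventually allI impI) (use Gx in metis)
  then show ?thesis unfolding caratheodory_solution_def using x(1,2) by blast
qed

section \<open>The universal feedback\<close>

text \<open>Rationalising the numerator removes the apparent singularity of \<^const>\<open>\<phi>\<close> at \<open>b = 0\<close> when
\<open>a < 0\<close>.\<close>

lemma \<phi>_of_neg:
  assumes "a < 0"
  shows "\<phi> a b = b / (sqrt (a\<^sup>2 + b\<^sup>2) - a)"
proof (cases "b = 0")
  case False
  have "sqrt (a\<^sup>2 + b\<^sup>2) - a > 0"
    using assms real_sqrt_ge_zero[of "a\<^sup>2 + b\<^sup>2"] by (simp add: less_le_trans)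
  moreover have "(a + sqrt (a\<^sup>2 + b\<^sup>2)) * (sqrt (a\<^sup>2 + b\<^sup>2) - a) = (sqrt (a\<^sup>2 + b\<^sup>2))\<^sup>2 - a\<^sup>2"
    by (simp add: power2_eq_square algebra_simps)
  then have "(a + sqrt (a\<^sup>2 + b\<^sup>2)) * (sqrt (a\<^sup>2 + b\<^sup>2) - a) = b * b"
    by (simp add: power2_eq_square)
  ultimately show ?thesis using False by (simp add: \<phi>_def frac_eq_eq)
qed (simp add: \<phi>_def)

text \<open>At nonzero states the Lyapunov condition confines the values \<open>(a, b)\<close> of \<^const>\<open>W_bar\<close> and
\<^const>\<open>W_tilde\<close> to the region \<open>b \<noteq> 0 \<or> a < 0\<close>, on
which Sontag's function is continuous.\<close>

lemma isCont_\<phi>: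
  fixes A B :: "'a::t2_space \<Rightarrow> real"
  assumes A: "isCont A x" and B: "isCont B x" and reg: "B x \<noteq> 0 \<or> A x < 0"
  shows "isCont (\<lambda>x. \<phi> (A x) (B x)) x"
proof (cases "B x = 0")
  case False
  have "eventually (\<lambda>y. B y \<noteq> 0) (nhds x)"
    using B False tendsto_imp_eventually_ne[of B "B x" "nhds x" 0] by (simp add: isCont_def tendsto_at_iff_tendsto_nhds)
  then have "eventually (\<lambda>y. \<phi> (A y) (B y) = (A y + sqrt ((A y)\<^sup>2 + (B y)\<^sup>2)) / B y) (nhds x)"
    by eventually_elim (simp add: \<phi>_def)
  moreover have "isCont (\<lambda>y. (A y + sqrt ((A y)\<^sup>2 + (B y)\<^sup>2)) / B y) x"
    using False by (intro continuous_intros A B) simp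
  ultimately show ?thesis by (subst isCont_cong)
next
  case True
  then have neg: "A x < 0" using reg by simp
  have "eventually (\<lambda>y. A y < 0) (nhds x)"
    using A neg order_tendstoD(2)[of A "A x" "nhds x" 0] by (simp add: isCont_def tendsto_at_iff_tendsto_nhds)
  then have "eventually (\<lambda>y. \<phi> (A y) (B y) = B y / (sqrt ((A y)\<^sup>2 + (B y)\<^sup>2) - A y)) (nhds x)"
    by eventually_elim (simp add: \<phi>_of_neg)
  moreover have "isCont (\<lambda>y. B y / (sqrt ((A y)\<^sup>2 + (B y)\<^sup>2) - A y)) x"
    using True neg by (intro continuous_intros A B) simp
  ultimately show ?thesis by (subst isCont_cong)
qed

lemma \<phi>_nonneg:
  assumes "b \<ge> 0"
  shows "\<phi> a b \<ge> 0"
proof -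
  have "a + sqrt (a\<^sup>2 + b\<^sup>2) \<ge> 0" using real_sqrt_ge_abs1[of a b] by linarith
  then show ?thesis using assms unfolding \<phi>_def by simp
qed

lemma \<phi>_decrease:
  assumes "b = 0 \<Longrightarrow> a < 0"
  shows "a - b * \<phi> a b \<le> 0"
  using assms by (cases "b = 0") (simp_all add: \<phi>_def)

text \<open>Controls the size of the feedback, whose norm is \<open>sqrt b * \<phi> a b\<close>, by the size
\<open>\<epsilon>\<close> of an admissible control, for \<open>a\<close> and \<open>b\<close> the values of \<^const>\<open>W_bar\<close> and
\<^const>\<open>W_tilde\<close>.\<close>

lemma sqrt_\<phi>_bound:
  assumes "b \<ge> 0" "\<epsilon> \<ge> 0" "a \<le> \<epsilon> * sqrt b"
  shows "sqrt b * \<phi> a b \<le> 2 * \<epsilon> + sqrt b"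
proof (cases "b = 0")
  case False
  define r where "r = sqrt b"
  have r: "r > 0" "b = r * r" using assms(1) False by (auto simp: r_def)
  have "sqrt (a\<^sup>2 + b\<^sup>2) \<le> \<bar>a\<bar> + b" using sqrt_sum_squares_le_sum_abs[of a b] assms(1) by simp
  moreover have "a + \<bar>a\<bar> \<le> 2 * (\<epsilon> * r)"
    using assms(2,3) r(1) by (cases "a \<ge> 0") (simp_all add: r_def)
  ultimately have "a + sqrt (a\<^sup>2 + b\<^sup>2) \<le> 2 * \<epsilon> * r + r * r"
    unfolding r(2) by linarith
  then have "(a + sqrt (a\<^sup>2 + b\<^sup>2)) / r \<le> (2 * \<epsilon> * r + r * r) / r" using r by (intro divide_right_mono) auto
  moreover have "r * \<phi> a b = (a + sqrt (a\<^sup>2 + b\<^sup>2)) / r" using r by (simp add: \<phi>_def)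
  moreover have "(2 * \<epsilon> * r + r * r) / r = 2 * \<epsilon> + r" using r by (simp add: field_simps)
  ultimately show ?thesis by (simp add: r_def)
qed (use assms in \<open>simp add: \<phi>_def\<close>)

abbreviation (input) closed_loop ::
  "(nat \<Rightarrow> 'a::real_normed_vector \<Rightarrow> 'a) \<Rightarrow> (nat \<Rightarrow> 'm::finite \<Rightarrow> 'a \<Rightarrow> 'a) \<Rightarrow> (nat \<Rightarrow> 'a \<Rightarrow> real) \<Rightarrow> real \<Rightarrow> nat \<Rightarrow> 'a \<Rightarrow> 'a" where
  "closed_loop f g V lam0 p x \<equiv> control_affine f g p (universal_feedback f g V lam0 p x) x"

lemma closed_loop_eq:
  "closed_loop f g V lam0 p x =
     f p x - \<phi> (W_bar f V lam0 p x) (W_tilde g V p x) *\<^sub>R (\<Sum>i\<in>UNIV. lie_derivative (g p i) (V p) x *\<^sub>R g p i x)"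
  by (simp add: control_affine_def universal_feedback_def scaleR_sum_right sum_negf mult.commute)

lemma W_tilde_eq_0_iff: "W_tilde g V p x = 0 \<longleftrightarrow> (\<forall>i. lie_derivative (g p i) (V p) x = 0)"
  unfolding W_tilde_def by (subst sum_nonneg_eq_0_iff) auto

lemma W_tilde_nonneg: "W_tilde g V p x \<ge> 0"
  unfolding W_tilde_def by (simp add: sum_nonneg)

lemma closed_loop_at_0:
  assumes "f p 0 = 0" "\<And>i. g p i 0 = 0"
  shows "closed_loop f g V lam0 p 0 = 0"
  using assms by (simp add: control_affine_def)

text \<open>Where the control has no influence on \<open>V p\<close>, the infimum over the controls is the drift itself.\<close>

lemma clf_drift_negative:
  fixes g :: "nat \<Rightarrow> 'm::finite \<Rightarrow> 'a::real_normed_vector \<Rightarrow> 'a"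
  assumes "(INF u::real ^ 'm. ereal (lie_derivative (f p) (V p) x + lam0 * V p x
              + (\<Sum>i\<in>UNIV. u $ i * lie_derivative (g p i) (V p) x))) < 0"
    and "W_tilde g V p x = 0"
  shows "W_bar f V lam0 p x < 0"
  using assms by (simp add: W_tilde_eq_0_iff W_bar_def)

text \<open>Sontag's formula is designed so that the drift and the control contribution together equal
\<open>- lam0 * V p x - sqrt (a\<^sup>2 + b\<^sup>2)\<close> whenever \<open>b \<noteq> 0\<close>, for
\<open>a\<close> and \<open>b\<close> the values of \<^const>\<open>W_bar\<close> and \<^const>\<open>W_tilde\<close>.\<close>

lemma closed_loop_dissipation:
  fixes V :: "nat \<Rightarrow> 'a::euclidean_space \<Rightarrow> real"
  assumes V: "C_k 1 (V p)" and neg: "W_tilde g V p x = 0 \<Longrightarrow> W_bar f V lam0 p x < 0"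
  shows "frechet_derivative (V p) (at x) (closed_loop f g V lam0 p x) \<le> - lam0 * V p x"
proof -
  let ?D = "frechet_derivative (V p) (at x)"
  let ?k = "\<phi> (W_bar f V lam0 p x) (W_tilde g V p x)"
  have lin: "linear ?D" using C1_has_derivative[OF V] has_derivative_linear by blast
  have "?D (closed_loop f g V lam0 p x) = lie_derivative (f p) (V p) x - ?k * W_tilde g V p x"
    unfolding closed_loop_eq
    by (simp add: linear_diff[OF lin] linear_scale[OF lin] linear_sum[OF lin] W_tilde_def lie_derivative_def power2_eq_square)
  also have "\<dots> = (W_bar f V lam0 p x - W_tilde g V p x * ?k) - lam0 * V p x"
    by (simp add: W_bar_def)
  also have "\<dots> \<le> - lam0 * V p x" using \<phi>_decrease[of "W_tilde g V p x" "W_bar f V lam0 p x"] neg by simp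
  finally show ?thesis .
qed

text \<open>The small control property enters only through this consequence of Cauchy-Schwarz.\<close>

lemma small_control_bound:
  fixes g :: "nat \<Rightarrow> 'm::finite \<Rightarrow> 'a::real_normed_vector \<Rightarrow> 'a" and u :: "real ^ 'm"
  assumes "norm u < \<epsilon>"
    and "lie_derivative (f p) (V p) x + (\<Sum>i\<in>UNIV. u $ i * lie_derivative (g p i) (V p) x) \<le> - lam0 * V p x"
  shows "W_bar f V lam0 p x \<le> \<epsilon> * sqrt (W_tilde g V p x)"
proof -
  let ?l = "(\<chi> i. lie_derivative (g p i) (V p) x) :: real ^ 'm"
  have nl: "norm ?l = sqrt (W_tilde g V p x)" by (simp add: norm_vec_def L2_set_def W_tilde_def)
  have "W_bar f V lam0 p x \<le> - (u \<bullet> ?l)" using assms(2) by (simp add: W_bar_def inner_vec_def)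
  also have "\<dots> \<le> norm u * norm ?l" using Cauchy_Schwarz_ineq2[of u ?l] by (simp add: abs_le_iff)
  also have "\<dots> \<le> \<epsilon> * norm ?l" using assms(1) by (intro mult_right_mono) auto
  finally show ?thesis by (simp add: nl)
qed

lemma lie_derivative_continuous:
  fixes V :: "'a::euclidean_space \<Rightarrow> real"
  assumes "C_k 1 V" "continuous_on UNIV h"
  shows "continuous_on UNIV (lie_derivative h V)"
  using C1_continuous_derivative[OF assms] by (simp add: lie_derivative_def[abs_def])

text \<open>Away from the origin continuity is that of \<^const>\<open>\<phi>\<close>. At the origin the feedback is bounded,
by the small control property with control size \<open>1\<close>, and it multiplies fields \<open>g p i\<close> that
vanish there.\<close>

lemma closed_loop_continuous:
  fixes V :: "nat \<Rightarrow> 'a::euclidean_space \<Rightarrow> real" and g :: "nat \<Rightarrow> 'm::finite \<Rightarrow> 'a \<Rightarrow> 'a"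
  assumes V: "C_k 1 (V p)" and f: "continuous_on UNIV (f p)" and g: "\<And>i. continuous_on UNIV (g p i)"
    and f0: "f p 0 = 0" and g0: "\<And>i. g p i 0 = 0"
    and neg: "\<And>x. x \<noteq> 0 \<Longrightarrow> W_tilde g V p x = 0 \<Longrightarrow> W_bar f V lam0 p x < 0"
    and small: "\<delta> > 0" "\<And>x. x \<noteq> 0 \<Longrightarrow> norm x < \<delta> \<Longrightarrow> W_bar f V lam0 p x \<le> sqrt (W_tilde g V p x)"
  shows "continuous_on UNIV (closed_loop f g V lam0 p)"
proof (rule continuous_at_imp_continuous_on, rule ballI)
  fix x :: 'a
  have VC: "isCont (V p) y" for y using C1_has_derivative[OF V] has_derivative_continuous by blast
  have lf: "isCont (lie_derivative (f p) (V p)) y" for y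
    using lie_derivative_continuous[OF V f] by (simp add: continuous_on_eq_continuous_at)
  have lg: "isCont (lie_derivative (g p i) (V p)) y" for i y
    using lie_derivative_continuous[OF V g] by (simp add: continuous_on_eq_continuous_at)
  have fc: "isCont (f p) y" for y using f by (simp add: continuous_on_eq_continuous_at)
  have gc: "isCont (g p i) y" for i y using g[of i] by (simp add: continuous_on_eq_continuous_at)
  have wb: "isCont (W_bar f V lam0 p) y" for y
    unfolding W_bar_def[abs_def] by (intro continuous_intros lf VC)
  have wt: "isCont (W_tilde g V p) y" for y
    unfolding W_tilde_def[abs_def] by (intro continuous_intros lg)
  show "isCont (closed_loop f g V lam0 p) x"
  proof (cases "x = 0")
    case False
    have "isCont (\<lambda>x. \<phi> (W_bar f V lam0 p x) (W_tilde g V p x)) x"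
      by (rule isCont_\<phi>[OF wb wt]) (use neg[OF False] in blast)
    then show ?thesis unfolding closed_loop_eq[abs_def]
      by (intro continuous_intros fc gc lg)
  next
    case True
    have "W_tilde g V p 0 = 0"
      unfolding W_tilde_eq_0_iff lie_derivative_def g0
      using linear_0[OF has_derivative_linear[OF C1_has_derivative[OF V]]] by blast
    then have "eventually (\<lambda>x. W_tilde g V p x < 1) (at 0)"
      using wt[of 0] order_tendstoD(2)[of "W_tilde g V p" 0 "at 0" 1] by (simp add: isCont_def)
    moreover have "eventually (\<lambda>x. x \<noteq> 0 \<and> norm x < \<delta>) (at (0::'a))"
      using small(1) unfolding eventually_at by (auto intro: exI[of _ \<delta>])
    ultimately have ev: "eventually (\<lambda>x. norm (closed_loop f g V lam0 p x) \<le> norm (f p x) + (\<Sum>i\<in>UNIV. 3 * norm (g p i x))) (at 0)"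
    proof eventually_elim
      case (elim x)
      let ?k = "\<phi> (W_bar f V lam0 p x) (W_tilde g V p x)" and ?r = "sqrt (W_tilde g V p x)"
      have "?r \<le> 1" using elim(1) by simp
      have "?r * ?k \<le> 2 * 1 + ?r"
        by (rule sqrt_\<phi>_bound[OF W_tilde_nonneg]) (use small(2)[of x] elim(2) in simp_all)
      then have rk: "?r * ?k \<le> 3" using \<open>?r \<le> 1\<close> by linarith
      have k0: "?k \<ge> 0" by (rule \<phi>_nonneg[OF W_tilde_nonneg])
      have "norm (?k *\<^sub>R lie_derivative (g p i) (V p) x *\<^sub>R g p i x) \<le> 3 * norm (g p i x)" for i
      proof -
        have "(lie_derivative (g p i) (V p) x)\<^sup>2 \<le> W_tilde g V p x"
          unfolding W_tilde_def by (rule member_le_sum) auto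
        then have "\<bar>lie_derivative (g p i) (V p) x\<bar> \<le> ?r" by (metis real_sqrt_abs real_sqrt_le_mono)
        then have "?k * \<bar>lie_derivative (g p i) (V p) x\<bar> \<le> ?k * ?r" using k0 by (rule mult_left_mono)
        also have "\<dots> \<le> 3" using rk by (simp add: mult.commute)
        finally have "(?k * \<bar>lie_derivative (g p i) (V p) x\<bar>) * norm (g p i x) \<le> 3 * norm (g p i x)"
          by (rule mult_right_mono) simp
        then show ?thesis using k0 by (simp add: abs_mult mult.assoc)
      qed
      then have "norm (\<Sum>i\<in>UNIV. ?k *\<^sub>R lie_derivative (g p i) (V p) x *\<^sub>R g p i x) \<le> (\<Sum>i\<in>UNIV. 3 * norm (g p i x))"
        by (intro sum_norm_le) simp
      then show ?case unfolding closed_loop_eq scaleR_sum_right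
        using norm_triangle_ineq4 order_trans add_left_mono by meson
    qed
    have "((\<lambda>x. norm (f p x) + (\<Sum>i\<in>UNIV. 3 * norm (g p i x))) \<longlongrightarrow> norm (f p 0) + (\<Sum>i\<in>UNIV. 3 * norm (g p i 0))) (at 0)"
      using fc[of 0] gc[where y = 0] unfolding isCont_def by (intro tendsto_intros) auto
    then have "((\<lambda>x. norm (f p x) + (\<Sum>i\<in>UNIV. 3 * norm (g p i x))) \<longlongrightarrow> 0) (at 0)" by (simp add: f0 g0)
    then have "(closed_loop f g V lam0 p \<longlongrightarrow> 0) (at 0)" by (rule Lim_null_comparison[OF ev])
    then show ?thesis using closed_loop_at_0[of f p g V lam0, OF f0 g0] True by (simp add: isCont_def)
  qed
qed

section \<open>Growth of the number of switches\<close>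

text \<open>The path is constant before and after its only switch, and the two constants differ because the
switch is a discontinuity.\<close>

lemma card_switch_times_short:
  assumes s: "cadlag s" and ab: "0 \<le> a" "a \<le> b" and le1: "card (switch_times s b \<inter> {a<..}) \<le> 1"
  shows "card (switch_times s b \<inter> {a<..}) = (if s a = s b then 0 else 1)"
proof -
  let ?S = "switch_times s b \<inter> {a<..}"
  have fin: "finite ?S" using finite_switch_times[OF s] by blast
  show ?thesis
  proof (cases "card ?S = 0")
    case True
    then have "?S = {}" using fin by simp
    then show ?thesis using no_switch_imp_constant[OF s ab] by simp
  next
    case False
    then have "card ?S = 1" using le1 by linarith
    then obtain r where r: "?S = {r}" by (meson card_1_singletonE)
    then have r1: "a < r" "r \<le> b" "\<not> isCont s r" and "r \<in> switch_times s b" by (auto simp: switch_times_def)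
    have r0: "r > 0" using r1 ab by linarith
    have "switch_times s b \<inter> {r<..} \<subseteq> ?S \<inter> {r<..}" using r1(1) by auto
    then have "switch_times s b \<inter> {r<..} = {}" unfolding r by auto
    then have sb: "s b = s r" using r0 r1(2) by (intro no_switch_imp_constant[OF s]) auto
    obtain l d where d: "d > 0" "d \<le> r" "\<And>u. r - d < u \<Longrightarrow> u < r \<Longrightarrow> s u = l" and "isCont s r \<longleftrightarrow> l = s r"
      using cadlag_two_sided[OF s r0] by metis
    then have "l \<noteq> s r" using r1 by blast
    define u where "u = max a (r - d / 2)"
    have u: "a \<le> u" "u < r" "r - d < u" using r1 d(1) by (auto simp: u_def)
    have "switch_times s u \<inter> {a<..} \<subseteq> ?S - {r}" using u r1 by (auto simp: switch_times_def)
    then have "switch_times s u \<inter> {a<..} = {}" using r by blast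
    then have "s u = s a" using u ab by (intro no_switch_imp_constant[OF s]) auto
    moreover have "s u = l" using d(3) u by blast
    ultimately show ?thesis using \<open>l \<noteq> s r\<close> sb \<open>card ?S = 1\<close> by simp
  qed
qed

text \<open>On a grid finer than the gaps between the finitely many switches, every cell contains at most one
switch, so the switches are counted by the visible changes of value.\<close>

lemma card_switch_times_eq_grid_changes:
  assumes s: "cadlag s" and t: "t \<ge> 0"
  shows "\<forall>\<^sub>F n in sequentially. card (switch_times s t)
    = (\<Sum>k<n. if s (t * real k / real n) = s (t * real (Suc k) / real n) then 0 else 1)"
proof -
  have "uniform_discrete (switch_times s t)"
    using finite_switch_times[OF s, of t] uniform_discrete_finite_iff by blast
  then obtain e where e: "e > 0" "\<And>x y. x \<in> switch_times s t \<Longrightarrow> y \<in> switch_times s t \<Longrightarrow> dist x y < e \<Longrightarrow> x = y"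
    unfolding uniform_discrete_def by blast
  have "\<forall>\<^sub>F n in sequentially. 0 < n \<and> t / real n < e"
  proof -
    have "(\<lambda>n. t / real n) \<longlonglongrightarrow> 0" by real_asymp
    then have "\<forall>\<^sub>F n in sequentially. t / real n < e" using e(1) by (rule order_tendstoD)
    then show ?thesis using eventually_gt_at_top[of 0] by eventually_elim simp
  qed
  then show ?thesis
  proof eventually_elim
    case (elim n)
    let ?g = "\<lambda>k. t * real k / real n"
    have g0: "?g k \<ge> 0" for k using t by simp
    have gm: "?g k \<le> ?g (Suc k)" for k using t by (intro divide_right_mono mult_left_mono) simp_all
    have step: "?g (Suc k) - ?g k = t / real n" for k by (simp add: algebra_simps add_divide_distrib)
    have "card (switch_times s (?g j)) = (\<Sum>k<j. if s (?g k) = s (?g (Suc k)) then 0 else 1)" if "j \<le> n" for j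
      using that
    proof (induction j)
      case 0 then show ?case by (simp add: switch_times_def)
    next
      case (Suc j)
      let ?S = "switch_times s (?g (Suc j)) \<inter> {?g j<..}"
      have fin: "finite ?S" using finite_switch_times[OF s] by blast
      have gt: "?g (Suc j) \<le> t"
      proof -
        have "t * real (Suc j) \<le> t * real n" using Suc.prems t by (intro mult_left_mono) simp_all
        then show ?thesis using elim by (simp add: pos_divide_le_eq)
      qed
      have "x = y" if "x \<in> ?S" "y \<in> ?S" for x y
      proof (rule e(2))
        show "x \<in> switch_times s t" "y \<in> switch_times s t" using that gt by (auto simp: switch_times_def)
        have "?g j < x" "x \<le> ?g (Suc j)" "?g j < y" "y \<le> ?g (Suc j)" using that by (auto simp: switch_times_def)
        then show "dist x y < e" using step[of j] elim unfolding dist_real_def by linarith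
      qed
      then have "card ?S \<le> 1" using fin by (simp add: card_le_Suc0_iff_eq)
      then have "card ?S = (if s (?g j) = s (?g (Suc j)) then 0 else 1)"
        by (rule card_switch_times_short[OF s g0 gm])
      then show ?case using card_switch_times_split[OF s gm[of j]] Suc.IH Suc.prems by simp
    qed
    from this[of n] show ?case using elim by simp
  qed
qed

lemma num_switches_eq: "num_switches \<sigma> t \<omega> = card (switch_times (\<lambda>r. \<sigma> r \<omega>) t)"
  by (simp add: num_switches_def switch_times_def)

text \<open>The hypothesis on the law of the number of switches carries information only if its level sets are
events, because the measure of a nonmeasurable set is \<open>0\<close> by convention. The grid counts
exhibit the number of switches as a pointwise limit of random variables.\<close>

lemma measurable_num_switches:
  assumes \<sigma>: "switching_signal M N \<sigma>" and t: "t \<ge> 0"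
  shows "num_switches \<sigma> t \<in> M \<rightarrow>\<^sub>M count_space UNIV"
proof -
  have ms: "\<sigma> u \<in> M \<rightarrow>\<^sub>M count_space UNIV" if "u \<ge> 0" for u
  proof -
    have "\<sigma> u \<in> M \<rightarrow>\<^sub>M count_space {1..N}" using \<sigma> that by (simp add: switching_signal_def)
    then show ?thesis using measurable_compose[of "\<sigma> u" M "count_space {1..N}" "\<lambda>x. x" "count_space UNIV"] by simp
  qed
  define c where "c n \<omega> = (\<Sum>k<n. if \<sigma> (t * real k / real n) \<omega> = \<sigma> (t * real (Suc k) / real n) \<omega> then 0 else (1::nat))" for n \<omega>
  have cm: "(\<lambda>\<omega>. real (c n \<omega>)) \<in> borel_measurable M" for n
  proof -
    have "(\<lambda>\<omega>. if \<sigma> a \<omega> = \<sigma> b \<omega> then 0 else (1::real)) \<in> borel_measurable M" if "a \<ge> 0" "b \<ge> 0" for a b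
    proof -
      have "{\<omega> \<in> space M. \<sigma> a \<omega> = \<sigma> b \<omega>} = (\<Union>j. (\<sigma> a -` {j} \<inter> space M) \<inter> (\<sigma> b -` {j} \<inter> space M))"
        by auto
      also have "\<dots> \<in> sets M"
        using measurable_sets[OF ms[OF that(1)]] measurable_sets[OF ms[OF that(2)]]
        by (intro sets.countable_UN image_subsetI) (rule sets.Int; simp)
      finally show ?thesis by (intro measurable_If) simp_all
    qed
    then have "(\<lambda>\<omega>. \<Sum>k<n. if \<sigma> (t * real k / real n) \<omega> = \<sigma> (t * real (Suc k) / real n) \<omega> then 0 else (1::real)) \<in> borel_measurable M"
      using t by (intro borel_measurable_sum) simp
    moreover have "real (c n \<omega>) = (\<Sum>k<n. if \<sigma> (t * real k / real n) \<omega> = \<sigma> (t * real (Suc k) / real n) \<omega> then 0 else (1::real))" for \<omega>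
      unfolding c_def of_nat_sum by (intro sum.cong) auto
    ultimately show ?thesis by simp
  qed
  have "(\<lambda>\<omega>. real (num_switches \<sigma> t \<omega>)) \<in> borel_measurable M"
  proof (rule borel_measurable_LIMSEQ_real[OF _ cm])
    fix \<omega> assume "\<omega> \<in> space M"
    then have "cadlag (\<lambda>r. \<sigma> r \<omega>)" using \<sigma> by (simp add: switching_signal_def)
    from card_switch_times_eq_grid_changes[OF this t]
    have "\<forall>\<^sub>F n in sequentially. real (c n \<omega>) = real (num_switches \<sigma> t \<omega>)"
      by eventually_elim (simp add: c_def num_switches_eq)
    then show "(\<lambda>n. real (c n \<omega>)) \<longlonglongrightarrow> real (num_switches \<sigma> t \<omega>)" by (rule tendsto_eventually)
  qed
  then have [measurable]: "(\<lambda>\<omega>. real (num_switches \<sigma> t \<omega>)) \<in> borel_measurable M" .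
  have "{\<omega> \<in> space M. real (num_switches \<sigma> t \<omega>) = real k} \<in> sets M" for k by measurable
  then show ?thesis
    by (intro measurable_count_space_eq2_countable[THEN iffD2]) (auto simp: vimage_def Int_def conj_commute)
qed

lemma nn_integral_nat_valued:
  fixes f :: "nat \<Rightarrow> ennreal"
  assumes [measurable]: "Z \<in> M \<rightarrow>\<^sub>M count_space UNIV"
  shows "(\<integral>\<^sup>+\<omega>. f (Z \<omega>) \<partial>M) = (\<Sum>k. f k * emeasure M {\<omega> \<in> space M. Z \<omega> = k})"
proof -
  have A: "{\<omega> \<in> space M. Z \<omega> = k} \<in> sets M" for k by measurable
  have "(\<integral>\<^sup>+\<omega>. f (Z \<omega>) \<partial>M) = (\<integral>\<^sup>+\<omega>. (\<Sum>k. f k * indicator {\<omega> \<in> space M. Z \<omega> = k} \<omega>) \<partial>M)"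
  proof (rule nn_integral_cong)
    fix \<omega> assume w: "\<omega> \<in> space M"
    have "(\<lambda>k. if k = Z \<omega> then f k else 0) sums f (Z \<omega>)" by (rule sums_single)
    moreover have "(\<lambda>k. if k = Z \<omega> then f k else 0) = (\<lambda>k. f k * indicator {\<omega> \<in> space M. Z \<omega> = k} \<omega>)"
      using w by (auto simp: indicator_def)
    ultimately show "f (Z \<omega>) = (\<Sum>k. f k * indicator {\<omega> \<in> space M. Z \<omega> = k} \<omega>)"
      by (simp add: sums_unique)
  qed
  also have "\<dots> = (\<Sum>k. \<integral>\<^sup>+\<omega>. f k * indicator {\<omega> \<in> space M. Z \<omega> = k} \<omega> \<partial>M)"
    by (rule nn_integral_suminf) (use A in measurable)
  also have "\<dots> = (\<Sum>k. f k * emeasure M {\<omega> \<in> space M. Z \<omega> = k})"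
    using A by (simp add: nn_integral_cmult_indicator)
  finally show ?thesis .
qed

text \<open>The Poisson-type tail makes the generating function of \<open>Z\<close> an exponential series; the finitely
many values below \<open>K\<close>, about which nothing is assumed, contribute at most
\<open>\<mu> ^ k\<close> each.\<close>

lemma expected_weight_bound:
  fixes Z :: "'w \<Rightarrow> nat"
  assumes "prob_space M" and Z: "Z \<in> M \<rightarrow>\<^sub>M count_space UNIV"
    and le: "\<And>k. k \<ge> K \<Longrightarrow> \<P>(\<omega> in M. Z \<omega> = k) \<le> a ^ k * b / fact k"
    and nn: "a \<ge> 0" "b \<ge> 0" "\<mu> \<ge> 0" "w \<ge> 0"
  shows "(\<integral>\<^sup>+\<omega>. ennreal (\<mu> ^ Z \<omega> * w) \<partial>M) \<le> ennreal ((\<Sum>k<K. \<mu> ^ k) * w + exp (\<mu> * a) * b * w)"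
proof -
  interpret prob_space M by fact
  let ?q = "\<lambda>k. (if k \<in> {..<K} then \<mu> ^ k * w else 0) + (\<mu> * a) ^ k /\<^sub>R fact k * (b * w)"
  have q0: "?q k \<ge> 0" for k using nn by (intro add_nonneg_nonneg) auto
  have "(\<integral>\<^sup>+\<omega>. ennreal (\<mu> ^ Z \<omega> * w) \<partial>M) = (\<Sum>k. ennreal (\<mu> ^ k * w) * emeasure M {\<omega> \<in> space M. Z \<omega> = k})"
    by (rule nn_integral_nat_valued[OF Z, of "\<lambda>k. ennreal (\<mu> ^ k * w)"])
  also have "\<dots> \<le> (\<Sum>k. ennreal (?q k))"
  proof (intro suminf_le summableI)
    fix k
    have "\<mu> ^ k * w * prob {\<omega> \<in> space M. Z \<omega> = k} \<le> ?q k"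
    proof (cases "k < K")
      case True
      have "\<mu> ^ k * w * prob {\<omega> \<in> space M. Z \<omega> = k} \<le> \<mu> ^ k * w * 1"
        using nn by (intro mult_left_mono) auto
      moreover have "(\<mu> * a) ^ k /\<^sub>R fact k * (b * w) \<ge> 0" using nn by auto
      ultimately show ?thesis using True by simp
    next
      case False
      then have "\<mu> ^ k * w * prob {\<omega> \<in> space M. Z \<omega> = k} \<le> \<mu> ^ k * w * (a ^ k * b / fact k)"
        using nn le[of k] by (intro mult_left_mono) auto
      also have "\<dots> = (\<mu> * a) ^ k /\<^sub>R fact k * (b * w)" by (simp add: power_mult_distrib field_simps)
      finally show ?thesis using False by simp
    qed
    moreover have "\<mu> ^ k * w \<ge> 0" using nn by simp
    ultimately show "ennreal (\<mu> ^ k * w) * emeasure M {\<omega> \<in> space M. Z \<omega> = k} \<le> ennreal (?q k)"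
      by (simp add: emeasure_eq_measure ennreal_mult[symmetric] ennreal_leI)
  qed
  also have "\<dots> = ennreal ((\<Sum>k<K. \<mu> ^ k * w) + exp (\<mu> * a) * (b * w))"
    by (rule suminf_ennreal_eq[OF q0])
       (intro sums_add sums_If_finite_set sums_mult2 exp_converges finite_lessThan)
  also have "(\<Sum>k<K. \<mu> ^ k * w) + exp (\<mu> * a) * (b * w) = (\<Sum>k<K. \<mu> ^ k) * w + exp (\<mu> * a) * b * w"
    by (simp add: sum_distrib_right)
  finally show ?thesis .
qed

text \<open>The integrated series is finite, so the series converges almost everywhere and its terms tend
to zero.\<close>

lemma AE_tendsto_zero_if_summable_expectation:
  fixes Y :: "nat \<Rightarrow> 'w \<Rightarrow> real"
  assumes Y: "\<And>n. Y n \<in> borel_measurable M" and Y0: "\<And>n \<omega>. Y n \<omega> \<ge> 0"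
    and le: "\<And>n. (\<integral>\<^sup>+\<omega>. ennreal (Y n \<omega>) \<partial>M) \<le> ennreal (e n)" and e: "summable e" "\<And>n. e n \<ge> 0"
  shows "AE \<omega> in M. (\<lambda>n. Y n \<omega>) \<longlonglongrightarrow> 0"
proof -
  have "(\<integral>\<^sup>+\<omega>. (\<Sum>n. ennreal (Y n \<omega>)) \<partial>M) = (\<Sum>n. \<integral>\<^sup>+\<omega>. ennreal (Y n \<omega>) \<partial>M)"
    using Y by (intro nn_integral_suminf) simp
  also have "\<dots> \<le> (\<Sum>n. ennreal (e n))" by (intro suminf_le summableI le)
  also have "\<dots> = ennreal (\<Sum>n. e n)" by (rule suminf_ennreal2) (use e in auto)
  also have "\<dots> < \<infinity>" by simp
  finally have fin: "(\<integral>\<^sup>+\<omega>. (\<Sum>n. ennreal (Y n \<omega>)) \<partial>M) \<noteq> \<infinity>" by simp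
  have "(\<lambda>\<omega>. \<Sum>n. ennreal (Y n \<omega>)) \<in> borel_measurable M"
    using Y by (intro borel_measurable_suminf_order) simp
  from nn_integral_PInf_AE[OF this fin] show ?thesis
  proof (rule AE_mp, intro AE_I2 impI)
    fix \<omega> assume "(\<Sum>n. ennreal (Y n \<omega>)) \<noteq> \<infinity>"
    then have "summable (\<lambda>n. Y n \<omega>)" using Y0 by (intro summable_suminf_not_top) simp_all
    then show "(\<lambda>n. Y n \<omega>) \<longlonglongrightarrow> 0" by (rule summable_LIMSEQ_zero)
  qed
qed

text \<open>At integer times \<open>n\<close> the expected weight is at most a geometric term of ratio \<open>exp (- lam0)\<close>,
coming from the small values of the count, plus one of ratio
\<open>exp (\<mu> * lam_bar - lam_tilde - lam0)\<close>; the last hypothesis makes the second ratio less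
than \<open>1\<close>.\<close>

lemma AE_switching_weight_tendsto_zero:
  assumes ps: "prob_space M" and \<sigma>: "switching_signal M N \<sigma>"
    and le: "\<And>k t. k \<ge> K \<Longrightarrow> t \<ge> 0 \<Longrightarrow>
           \<P>(\<omega> in M. num_switches \<sigma> t \<omega> = k) \<le> (lam_bar * t) ^ k * exp (- lam_tilde * t) / fact k"
    and pos: "lam_bar > 0" "lam0 > 0" "\<mu> > 0" and c: "\<mu> * lam_bar < lam0 + lam_tilde"
  shows "AE \<omega> in M. (\<lambda>n. \<mu> ^ num_switches \<sigma> (real n) \<omega> * exp (- lam0 * real n)) \<longlonglongrightarrow> 0"
proof -
  let ?A = "\<Sum>k<K. \<mu> ^ k" and ?c = "lam0 + lam_tilde - \<mu> * lam_bar"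
  let ?e = "\<lambda>n. ?A * exp (- lam0) ^ n + exp (- ?c) ^ n"
  have A0: "?A \<ge> 0" using pos by (intro sum_nonneg) simp
  show ?thesis
  proof (rule AE_tendsto_zero_if_summable_expectation[where e = ?e])
    fix n
    have e1: "exp (- lam0 * real n) = exp (- lam0) ^ n"
      by (simp add: exp_of_nat_mult[symmetric] mult.commute)
    note [measurable] = measurable_num_switches[OF \<sigma>, of "real n", simplified]
    show "(\<lambda>\<omega>. \<mu> ^ num_switches \<sigma> (real n) \<omega> * exp (- lam0 * real n)) \<in> borel_measurable M"
      by measurable
    have "(\<integral>\<^sup>+\<omega>. ennreal (\<mu> ^ num_switches \<sigma> (real n) \<omega> * exp (- lam0 * real n)) \<partial>M)
      \<le> ennreal (?A * exp (- lam0 * real n) + exp (\<mu> * (lam_bar * real n)) * exp (- lam_tilde * real n) * exp (- lam0 * real n))"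
      using pos by (intro expected_weight_bound[OF ps _ le]) simp_all
    also have "exp (\<mu> * (lam_bar * real n)) * exp (- lam_tilde * real n) * exp (- lam0 * real n) = exp (- ?c) ^ n"
      by (simp add: exp_add[symmetric] exp_of_nat_mult[symmetric] algebra_simps)
    finally show "(\<integral>\<^sup>+\<omega>. ennreal (\<mu> ^ num_switches \<sigma> (real n) \<omega> * exp (- lam0 * real n)) \<partial>M) \<le> ennreal (?e n)"
      by (simp only: e1)
    show "?e n \<ge> 0" using A0 by simp
    show "\<mu> ^ num_switches \<sigma> (real n) \<omega> * exp (- lam0 * real n) \<ge> 0" for \<omega> using pos by simp
  next
    show "summable ?e" using pos c by (intro summable_add summable_mult summable_geometric) simp_all
  qed
qed

text \<open>The count is monotone in time, so between integer times the weight exceeds its value at the next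
integer by at most the factor \<open>exp lam0\<close>.\<close>

lemma switching_weight_bounds:
  assumes s: "cadlag s" and \<mu>: "\<mu> \<ge> 1" and lam: "lam0 \<ge> 0"
    and lim: "(\<lambda>n. \<mu> ^ card (switch_times s (real n)) * exp (- lam0 * real n)) \<longlonglongrightarrow> 0"
  shows "\<exists>B. \<forall>t\<ge>0. \<mu> ^ card (switch_times s t) * exp (- lam0 * t) \<le> B"
    and "e > 0 \<Longrightarrow> \<exists>T\<ge>0. \<forall>t\<ge>T. \<mu> ^ card (switch_times s t) * exp (- lam0 * t) \<le> e"
proof -
  define w where "w t = \<mu> ^ card (switch_times s t) * exp (- lam0 * t)" for t
  have lim: "(\<lambda>n. w (real n)) \<longlonglongrightarrow> 0" using lim by (simp add: w_def)
  have key: "w t \<le> w (real (nat \<lceil>t\<rceil>)) * exp lam0" if "t \<ge> 0" for t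
  proof -
    let ?n = "real (nat \<lceil>t\<rceil>)"
    have n: "t \<le> ?n" "?n \<le> t + 1" using that by linarith+
    have "w t \<le> \<mu> ^ card (switch_times s ?n) * exp (- lam0 * ?n + lam0)"
      unfolding w_def
    proof (intro mult_mono power_increasing card_switch_times_mono[OF s n(1)] \<mu>)
      have "lam0 * ?n \<le> lam0 * (t + 1)" using n(2) lam by (rule mult_left_mono)
      then show "exp (- lam0 * t) \<le> exp (- lam0 * ?n + lam0)" by (simp add: algebra_simps)
    qed (use \<mu> in auto)
    then show ?thesis unfolding w_def exp_add by (simp only: mult.assoc)
  qed
  show "\<exists>B. \<forall>t\<ge>0. \<mu> ^ card (switch_times s t) * exp (- lam0 * t) \<le> B"
  proof -
    have "Bseq (\<lambda>n. w (real n))" using lim convergent_def convergent_imp_Bseq by blast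
    then obtain C where C: "\<And>n. norm (w (real n)) \<le> C" by (auto simp: Bseq_def)
    have "w t \<le> C * exp lam0" if "t \<ge> 0" for t
    proof (rule order_trans[OF key[OF that]])
      show "w (real (nat \<lceil>t\<rceil>)) * exp lam0 \<le> C * exp lam0"
        using C[of "nat \<lceil>t\<rceil>"] by (intro mult_right_mono) (simp_all add: abs_le_iff)
    qed
    then show ?thesis unfolding w_def by blast
  qed
  show "\<exists>T\<ge>0. \<forall>t\<ge>T. \<mu> ^ card (switch_times s t) * exp (- lam0 * t) \<le> e" if e: "e > 0"
  proof -
    have "\<forall>\<^sub>F n in sequentially. w (real n) < e / exp lam0"
      using order_tendstoD(2)[OF lim] e by simp
    then obtain n0 where n0: "\<And>n. n \<ge> n0 \<Longrightarrow> w (real n) < e / exp lam0"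
      unfolding eventually_sequentially by blast
    have "w t \<le> e" if t: "t \<ge> real n0" for t
    proof -
      have "nat \<lceil>t\<rceil> \<ge> n0" using t by linarith
      then have "w (real (nat \<lceil>t\<rceil>)) * exp lam0 \<le> e" using n0[of "nat \<lceil>t\<rceil>"] by (simp add: pos_less_divide_eq less_imp_le)
      moreover have "t \<ge> 0" using t by linarith
      ultimately show ?thesis using key[of t] by linarith
    qed
    then show ?thesis unfolding w_def by (intro exI[of _ "real n0"]) simp
  qed
qed

section \<open>Almost sure stability\<close>

text \<open>Completeness supplies the measurability of the stability events, which quantify over
uncountably many solutions.\<close>

lemma prob_eq_1_if_AE_complete:
  assumes "prob_space M" "complete_measure M" "AE \<omega> in M. P \<omega>"
  shows "\<P>(\<omega> in M. P \<omega>) = 1"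
proof -
  interpret prob_space M by fact
  interpret complete_measure M by fact
  obtain Z where Z: "{\<omega> \<in> space M. \<not> P \<omega>} \<subseteq> Z" "Z \<in> null_sets M"
    using assms(3) unfolding eventually_ae_filter by blast
  then have "{\<omega> \<in> space M. \<not> P \<omega>} \<in> sets M" by (rule complete)
  then have "space M - {\<omega> \<in> space M. \<not> P \<omega>} \<in> sets M" by (rule sets.compl_sets)
  moreover have "space M - {\<omega> \<in> space M. \<not> P \<omega>} = {\<omega> \<in> space M. P \<omega>}" by auto
  ultimately show ?thesis using assms(3) by (simp add: prob_Collect_eq_1)
qed

lemma class_K_le_cancel:
  assumes "class_K \<alpha>" "0 \<le> r" "0 \<le> r'" "\<alpha> r \<le> \<alpha> r'"
  shows "r \<le> r'"
proof (rule ccontr)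
  assume "\<not> r \<le> r'"
  then have "\<alpha> r' < \<alpha> r"
    using assms(1-3) strict_mono_onD[of "{0..}" \<alpha> r' r] by (simp add: class_K_def)
  then show False using assms(4) by simp
qed

lemma class_K_mono:
  assumes "class_K \<alpha>" "0 \<le> r" "r \<le> r'"
  shows "\<alpha> r \<le> \<alpha> r'"
  using assms unfolding class_K_def
  using strict_mono_onD[of "{0..}" \<alpha> r r'] by (cases "r = r'") simp_all

lemma class_K_pos:
  assumes "class_K \<alpha>" "r > 0"
  shows "\<alpha> r > 0"
  using assms strict_mono_onD[of "{0..}" \<alpha> 0 r] by (simp add: class_K_def)

lemma class_K_small:
  assumes "class_K \<alpha>" "e > 0"
  obtains d where "d > 0" "\<And>r. 0 \<le> r \<Longrightarrow> r < d \<Longrightarrow> \<alpha> r < e"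
proof -
  have "continuous_on {0..} \<alpha>" "\<alpha> 0 = 0" using assms(1) by (auto simp: class_K_def)
  then obtain d where d: "d > 0" "\<And>r. r \<in> {0..} \<Longrightarrow> dist r 0 < d \<Longrightarrow> dist (\<alpha> r) 0 < e"
    using assms(2) unfolding continuous_on_iff by (metis atLeast_iff order_refl)
  show ?thesis
  proof (rule that[OF d(1)])
    fix r :: real assume "0 \<le> r" "r < d"
    then show "\<alpha> r < e" using d(2)[of r] by (auto simp: dist_real_def)
  qed
qed

lemma class_K_inf_sublevel_bounded:
  assumes "class_K_inf \<alpha>" "\<And>y. \<alpha> (norm y) \<le> v y"
  shows "bounded {y. v y \<le> K}"
proof -
  have "\<forall>\<^sub>F r in at_top. K < \<alpha> r" using assms(1) by (simp add: class_K_inf_def filterlim_at_top_dense)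
  then obtain R where R: "\<And>r. r \<ge> R \<Longrightarrow> K < \<alpha> r" unfolding eventually_at_top_linorder by blast
  have "norm y \<le> R" if "v y \<le> K" for y
  proof (rule ccontr)
    assume "\<not> norm y \<le> R"
    then have "K < \<alpha> (norm y)" by (intro R) simp
    then show False using assms(2)[of y] that by linarith
  qed
  then show ?thesis unfolding bounded_iff by blast
qed

lemma SUP_norm_less:
  assumes "e > 0" "\<And>t. t \<in> S \<Longrightarrow> norm (x t) \<le> e / 2"
  shows "(SUP t\<in>S. ereal (norm (x t))) < ereal e"
proof -
  have "(SUP t\<in>S. ereal (norm (x t))) \<le> ereal (e / 2)" using assms(2) by (intro SUP_least) simp
  also have "\<dots> < ereal e" using assms(1) by simp
  finally show ?thesis .
qed

theorem theorem4p3: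
  fixes M :: "'w measure"
    and \<F> :: "real \<Rightarrow> 'w measure"
    and N :: nat
    and \<sigma> :: "real \<Rightarrow> 'w \<Rightarrow> nat"
    and f :: "nat \<Rightarrow> real ^ 'n \<Rightarrow> real ^ 'n"
    and g :: "nat \<Rightarrow> 'm::finite \<Rightarrow> real ^ 'n \<Rightarrow> real ^ 'n"
    and V :: "nat \<Rightarrow> real ^ 'n \<Rightarrow> real"
    and \<alpha>\<^sub>1 \<alpha>\<^sub>2 :: "real \<Rightarrow> real"
    and lam_tilde lam_bar lam0 \<mu> :: real
    and M0 :: nat
  assumes "prob_space M" and "complete_measure M"
    and "switching_signal M N \<sigma>" and "is_natural_filtration M \<sigma> \<F>"
    and "\<And>p. p \<in> {1..N} \<Longrightarrow> smooth (f p)"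
    and "\<And>p i. p \<in> {1..N} \<Longrightarrow> smooth (g p i)"
    and "\<And>p. p \<in> {1..N} \<Longrightarrow> f p 0 = 0"
    and "\<And>p i. p \<in> {1..N} \<Longrightarrow> g p i 0 = 0"
    and "lam_tilde > 0" and "lam_bar > 0"
    and "\<And>k t. k \<ge> M0 \<Longrightarrow> t \<ge> 0 \<Longrightarrow>
           \<P>(\<omega> in M. num_switches \<sigma> t \<omega> = k)
             \<le> (lam_bar * t) ^ k * exp (- lam_tilde * t) / fact k"
    and "\<And>p. p \<in> {1..N} \<Longrightarrow> C_k 1 (V p)"
    and "\<And>p x. p \<in> {1..N} \<Longrightarrow> V p x \<ge> 0"
    and "class_K_inf \<alpha>\<^sub>1" and "class_K_inf \<alpha>\<^sub>2"
    and "lam0 > 0" and "\<mu> > 1"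
    and C1: "\<And>p x. p \<in> {1..N} \<Longrightarrow> \<alpha>\<^sub>1 (norm x) \<le> V p x \<and> V p x \<le> \<alpha>\<^sub>2 (norm x)"
    and C2: "\<And>p q x. p \<in> {1..N} \<Longrightarrow> q \<in> {1..N} \<Longrightarrow> V p x \<le> \<mu> * V q x"
    and C3: "\<And>p x. p \<in> {1..N} \<Longrightarrow> x \<noteq> 0 \<Longrightarrow>
           (INF u::real ^ 'm. ereal (lie_derivative (f p) (V p) x + lam0 * V p x
              + (\<Sum>i\<in>UNIV. u $ i * lie_derivative (g p i) (V p) x))) < 0"
    and C4: "\<forall>\<epsilon>>0. \<exists>\<delta>>0. \<forall>x. x \<noteq> 0 \<and> norm x < \<delta> \<longrightarrow>
           (\<exists>u::real ^ 'm. norm u < \<epsilon> \<and>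
              (\<forall>p\<in>{1..N}. lie_derivative (f p) (V p) x
                 + (\<Sum>i\<in>UNIV. u $ i * lie_derivative (g p i) (V p) x) \<le> - lam0 * V p x))"
    and C5: "\<mu> < (lam0 + lam_tilde) / lam_bar"
  shows "gas_almost_surely M \<sigma>
           (\<lambda>p x. control_affine f g p (universal_feedback f g V lam0 p x) x)"
proof -
  \<comment> \<open>Continuity \<open>Fc\<close> and dissipation \<open>dis\<close> concern the feedback alone; \<open>decay\<close> and \<open>exists\<close> hold for
  every path. Chance enters only through \<open>good\<close>.\<close>
  note ps = assms(1) and cm = assms(2) and \<sigma> = assms(3) and f_smooth = assms(5) and g_smooth = assms(6)
    and f0 = assms(7) and g0 = assms(8) and lam_bar = assms(10) and Ple = assms(11) and V = assms(12)
    and V0 = assms(13) and K1 = assms(14) and K2 = assms(15) and lam0 = assms(16) and mu = assms(17)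
  let ?F = "closed_loop f g V lam0"
  let ?P = "{1..N}"
  have k1: "class_K \<alpha>\<^sub>1" and k2: "class_K \<alpha>\<^sub>2" using K1 K2 by (simp_all add: class_K_inf_def)
  have fc: "continuous_on UNIV (f p)" if "p \<in> ?P" for p
    using f_smooth[OF that] unfolding smooth_def by (metis C_k.simps(1))
  have gc: "continuous_on UNIV (g p i)" if "p \<in> ?P" for p i
    using g_smooth[OF that, of i] unfolding smooth_def by (metis C_k.simps(1))
  have neg: "W_bar f V lam0 p x < 0" if "p \<in> ?P" "x \<noteq> 0" "W_tilde g V p x = 0" for p x
    by (rule clf_drift_negative[of f p V x lam0 g, OF C3[OF that(1,2)] that(3)])
  have Fc: "continuous_on UNIV (?F p)" if p: "p \<in> ?P" for p
  proof -
    obtain \<delta> where d: "\<delta> > 0" and u: "\<And>x. x \<noteq> 0 \<Longrightarrow> norm x < \<delta> \<Longrightarrow>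
        \<exists>u::real ^ 'm. norm u < 1 \<and> (\<forall>p\<in>?P. lie_derivative (f p) (V p) x
          + (\<Sum>i\<in>UNIV. u $ i * lie_derivative (g p i) (V p) x) \<le> - lam0 * V p x)"
      using C4[rule_format, OF zero_less_one] by blast
    have "W_bar f V lam0 p x \<le> sqrt (W_tilde g V p x)" if x: "x \<noteq> 0" "norm x < \<delta>" for x
    proof -
      obtain u :: "real ^ 'm" where u: "norm u < 1" "lie_derivative (f p) (V p) x
          + (\<Sum>i\<in>UNIV. u $ i * lie_derivative (g p i) (V p) x) \<le> - lam0 * V p x"
        using u[OF x] p by blast
      from small_control_bound[where f = f and p = p and g = g and V = V and ?lam0.0 = lam0, OF this] show ?thesis by simp
    qed
    note small = this
    show ?thesis
      by (rule closed_loop_continuous[where f = f and p = p and g = g and V = V and ?lam0.0 = lam0, OF V[OF p] fc[OF p] gc[OF p] f0[OF p] g0[OF p] neg[OF p] d small])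
  qed
  have dis: "frechet_derivative (V p) (at x) (?F p x) \<le> - lam0 * V p x" if p: "p \<in> ?P" for p x
  proof (cases "x = 0")
    case True
    have "?F p 0 = 0" by (rule closed_loop_at_0[of f p g V lam0, OF f0[OF p] g0[OF p]])
    moreover have "V p 0 = 0" using C1[OF p, of 0] k1 k2 by (simp add: class_K_def)
    moreover have "frechet_derivative (V p) (at 0) 0 = 0"
      using linear_0[OF has_derivative_linear[OF C1_has_derivative[OF V[OF p]]]] .
    ultimately show ?thesis using True by simp
  next
    case False
    show ?thesis by (rule closed_loop_dissipation[where f = f and p = p and g = g and V = V and ?lam0.0 = lam0, OF V[OF p] neg[OF p False]])
  qed
  have cad: "cadlag (\<lambda>t. \<sigma> t \<omega>)" if "\<omega> \<in> space M" for \<omega>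
    using \<sigma> that by (simp add: switching_signal_def)
  have \<sigma>P: "\<sigma> t \<omega> \<in> ?P" if "\<omega> \<in> space M" "t \<ge> 0" for \<omega> t
  proof -
    have "\<sigma> t \<in> M \<rightarrow>\<^sub>M count_space ?P" using \<sigma> that(2) by (simp add: switching_signal_def)
    from measurable_space[OF this that(1)] show ?thesis by simp
  qed
  let ?w = "\<lambda>\<omega> t. \<mu> ^ card (switch_times (\<lambda>r. \<sigma> r \<omega>) t) * exp (- lam0 * t)"
  have decay: "\<alpha>\<^sub>1 (norm (x t)) \<le> ?w \<omega> t * \<alpha>\<^sub>2 (norm x0)"
    if w: "\<omega> \<in> space M" and sol: "switched_solution ?F \<sigma> \<omega> x0 x" and t: "t \<ge> 0" for \<omega> x0 x t
  proof -
    have x: "x 0 = x0" "\<And>T. T \<ge> 0 \<Longrightarrow> abs_continuous_on 0 T x"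
      "AE t in lebesgue. 0 < t \<longrightarrow> (x has_vector_derivative ?F (\<sigma> t \<omega>) (x t)) (at t)"
      using sol by (simp_all add: switched_solution_def caratheodory_solution_def)
    have "V (\<sigma> t \<omega>) (x t) \<le> ?w \<omega> t * V (\<sigma> 0 \<omega>) (x 0)"
      by (rule switched_decay[where s = "\<lambda>t. \<sigma> t \<omega>" and P = ?P and V = V and G = "\<lambda>t. ?F (\<sigma> t \<omega>)" and x = x,
            OF cad[OF w] \<sigma>P[OF w] V _ C2 x(2) x(3) dis[OF \<sigma>P[OF w less_imp_le]] t])
         (use mu in simp_all)
    moreover have "?w \<omega> t * V (\<sigma> 0 \<omega>) (x 0) \<le> ?w \<omega> t * \<alpha>\<^sub>2 (norm x0)"
      using C1[OF \<sigma>P[OF w, of 0], of x0] mu x(1) by (intro mult_left_mono) simp_all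
    ultimately show ?thesis using C1[OF \<sigma>P[OF w t], of "x t"] by linarith
  qed
  have exists: "\<exists>x. switched_solution ?F \<sigma> \<omega> x0 x" if w: "\<omega> \<in> space M" for \<omega> x0
    unfolding switched_solution_def
  proof (rule switched_solution_exists[where s = "\<lambda>t. \<sigma> t \<omega>" and P = ?P and V = V and \<mu> = \<mu>,
        OF cad[OF w] \<sigma>P[OF w] _ V V0 _ C2 _ Fc])
    show "bounded {y. V p y \<le> K}" if "p \<in> ?P" for p K
      using class_K_inf_sublevel_bounded[OF K1, of "V p"] C1[OF that] by blast
    show "frechet_derivative (V p) (at y) (?F p y) \<le> 0" if "p \<in> ?P" for p y
      using dis[OF that, of y] V0[OF that, of y] lam0 mult_nonneg_nonneg[of lam0 "V p y"] by linarith
  qed (use mu in simp_all)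
  have "\<mu> * lam_bar < lam0 + lam_tilde" using C5 lam_bar by (simp add: pos_less_divide_eq)
  then have "AE \<omega> in M. (\<lambda>n. \<mu> ^ num_switches \<sigma> (real n) \<omega> * exp (- lam0 * real n)) \<longlonglongrightarrow> 0"
    using mu by (intro AE_switching_weight_tendsto_zero[OF ps \<sigma> Ple lam_bar lam0]) simp_all
  then have good: "AE \<omega> in M. \<omega> \<in> space M \<and> (\<lambda>n. ?w \<omega> (real n)) \<longlonglongrightarrow> 0"
    by (rule AE_mp, intro AE_I2 impI) (simp add: num_switches_eq)
  have "\<P>(\<omega> in M. \<forall>x0. \<exists>x. switched_solution ?F \<sigma> \<omega> x0 x) = 1"
    by (rule prob_eq_1_if_AE_complete[OF ps cm]) (intro AE_I2 allI exists)
  moreover have "\<P>(\<omega> in M. \<forall>\<epsilon>>0. \<exists>\<delta>>0. \<forall>x0 x. switched_solution ?F \<sigma> \<omega> x0 x \<longrightarrow>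
        norm x0 < \<delta> \<longrightarrow> (SUP t\<in>{0..}. ereal (norm (x t))) < ereal \<epsilon>) = 1"
  proof (rule prob_eq_1_if_AE_complete[OF ps cm], rule AE_mp[OF good], intro AE_I2 impI allI)
    fix \<omega> and \<epsilon> :: real assume w: "\<omega> \<in> space M \<and> (\<lambda>n. ?w \<omega> (real n)) \<longlonglongrightarrow> 0" and e: "\<epsilon> > 0"
    from w have w1: "\<omega> \<in> space M" and w2: "(\<lambda>n. ?w \<omega> (real n)) \<longlonglongrightarrow> 0" by blast+
    obtain B where B: "\<And>t. t \<ge> 0 \<Longrightarrow> ?w \<omega> t \<le> B"
      using switching_weight_bounds(1)[OF cad[OF w1] _ _ w2] mu lam0 less_imp_le by blast
    have "?w \<omega> 0 > 0" using mu by simp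
    then have B0: "B > 0" using B[of 0] by linarith
    have a1: "\<alpha>\<^sub>1 (\<epsilon> / 2) > 0" by (rule class_K_pos[OF k1]) (use e in simp)
    then obtain \<delta> where d: "\<delta> > 0" "\<And>r. 0 \<le> r \<Longrightarrow> r < \<delta> \<Longrightarrow> \<alpha>\<^sub>2 r < \<alpha>\<^sub>1 (\<epsilon> / 2) / B"
      using class_K_small[OF k2, of "\<alpha>\<^sub>1 (\<epsilon> / 2) / B"] B0 by auto
    show "\<exists>\<delta>>0. \<forall>x0 x. switched_solution ?F \<sigma> \<omega> x0 x \<longrightarrow>
        norm x0 < \<delta> \<longrightarrow> (SUP t\<in>{0..}. ereal (norm (x t))) < ereal \<epsilon>"
    proof (intro exI[of _ \<delta>] conjI allI impI SUP_norm_less e d(1))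
      fix x0 x t assume sol: "switched_solution ?F \<sigma> \<omega> x0 x" and x0: "norm x0 < \<delta>" and t: "t \<in> {0::real..}"
      have "\<alpha>\<^sub>1 (norm (x t)) \<le> ?w \<omega> t * \<alpha>\<^sub>2 (norm x0)" by (rule decay[OF w1 sol]) (use t in simp)
      also have "\<dots> \<le> B * (\<alpha>\<^sub>1 (\<epsilon> / 2) / B)"
      proof (rule mult_mono)
        show "\<alpha>\<^sub>2 (norm x0) \<le> \<alpha>\<^sub>1 (\<epsilon> / 2) / B" using d(2)[OF norm_ge_zero x0] by simp
        show "0 \<le> \<alpha>\<^sub>2 (norm x0)"
          using class_K_mono[OF k2 order_refl norm_ge_zero, of x0] k2 by (simp add: class_K_def)
      qed (use B[of t] t B0 in simp_all)
      also have "\<dots> = \<alpha>\<^sub>1 (\<epsilon> / 2)" using B0 by simp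
      finally have "\<alpha>\<^sub>1 (norm (x t)) \<le> \<alpha>\<^sub>1 (\<epsilon> / 2)" .
      then show "norm (x t) \<le> \<epsilon> / 2" using class_K_le_cancel[OF k1 norm_ge_zero, of "\<epsilon> / 2"] e by simp
    qed
  qed
  moreover have "\<P>(\<omega> in M. \<forall>r>0. \<forall>\<epsilon>'>0. \<exists>T\<ge>0. \<forall>x0 x. switched_solution ?F \<sigma> \<omega> x0 x \<longrightarrow>
        norm x0 < r \<longrightarrow> (SUP t\<in>{T..}. ereal (norm (x t))) < ereal \<epsilon>') = 1"
  proof (rule prob_eq_1_if_AE_complete[OF ps cm], rule AE_mp[OF good], intro AE_I2 impI allI)
    fix \<omega> and r \<epsilon> :: real assume w: "\<omega> \<in> space M \<and> (\<lambda>n. ?w \<omega> (real n)) \<longlonglongrightarrow> 0" and r: "r > 0" and e: "\<epsilon> > 0"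
    from w have w1: "\<omega> \<in> space M" and w2: "(\<lambda>n. ?w \<omega> (real n)) \<longlonglongrightarrow> 0" by blast+
    have a1: "\<alpha>\<^sub>1 (\<epsilon> / 2) > 0" by (rule class_K_pos[OF k1]) (use e in simp)
    have a2: "\<alpha>\<^sub>2 r > 0" by (rule class_K_pos[OF k2 r])
    obtain T where T: "T \<ge> 0" "\<And>t. t \<ge> T \<Longrightarrow> ?w \<omega> t \<le> \<alpha>\<^sub>1 (\<epsilon> / 2) / \<alpha>\<^sub>2 r"
      using switching_weight_bounds(2)[OF cad[OF w1] _ _ w2, of "\<alpha>\<^sub>1 (\<epsilon> / 2) / \<alpha>\<^sub>2 r"] mu lam0 a1 a2
        less_imp_le divide_pos_pos by blast
    show "\<exists>T\<ge>0. \<forall>x0 x. switched_solution ?F \<sigma> \<omega> x0 x \<longrightarrow>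
        norm x0 < r \<longrightarrow> (SUP t\<in>{T..}. ereal (norm (x t))) < ereal \<epsilon>"
    proof (intro exI[of _ T] conjI allI impI SUP_norm_less e T(1))
      fix x0 x t assume sol: "switched_solution ?F \<sigma> \<omega> x0 x" and x0: "norm x0 < r" and t: "t \<in> {T..}"
      have "\<alpha>\<^sub>1 (norm (x t)) \<le> ?w \<omega> t * \<alpha>\<^sub>2 (norm x0)" by (rule decay[OF w1 sol]) (use t T(1) in simp)
      also have "\<dots> \<le> (\<alpha>\<^sub>1 (\<epsilon> / 2) / \<alpha>\<^sub>2 r) * \<alpha>\<^sub>2 r"
      proof (rule mult_mono)
        show "\<alpha>\<^sub>2 (norm x0) \<le> \<alpha>\<^sub>2 r" by (rule class_K_mono[OF k2]) (use x0 in simp_all)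
        show "0 \<le> \<alpha>\<^sub>2 (norm x0)"
          using class_K_mono[OF k2 order_refl norm_ge_zero, of x0] k2 by (simp add: class_K_def)
      qed (use T(2)[of t] t a1 a2 in simp_all)
      also have "\<dots> = \<alpha>\<^sub>1 (\<epsilon> / 2)" using a2 by simp
      finally have "\<alpha>\<^sub>1 (norm (x t)) \<le> \<alpha>\<^sub>1 (\<epsilon> / 2)" .
      then show "norm (x t) \<le> \<epsilon> / 2" using class_K_le_cancel[OF k1 norm_ge_zero, of "\<epsilon> / 2"] e by simp
    qed
  qed
  ultimately show ?thesis unfolding gas_almost_surely_def by blast
qed

end
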